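(* Let $F$ be a Ferrers shape and fix a filling of $F$ with non-negative integers. Complete it to a labelling of the corners of $F$ by partitions according to dual RSK' (as described in the context). Let $c=(x,y)$ be a corner of a cell of $F$, let $\lambda=(\lambda_1,\dots,\lambda_\ell)$ be the partition labelling $c$, with conjugate $\lambda'$, and let $R_c$ be the set of cells of $F$ in columns $\le x$ and rows $\le y$. Then: (1) for every $k\ge1$, considering collections of $k$ ne-chains in $R_c$ such that no cell with entry $e$ lies in more than $e$ of the chains, the maximal cardinality of the multiset union of the chains in such a collection equals $\lambda_1+\dots+\lambda_k$; (2) for every $k\ge1$, the maximal sum of all entries in a collection of $k$ pairwise disjoint SE-chains in $R_c$ equals $\lambda'_1+\dots+\lambda'_k$. In particular $\lambda_1$ is the length of the longest ne-chain in $R_c$ and $\lambda'_1$ is the length of the longest SE-chain in $R_c$.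
   Context: A Ferrers shape (French notation) has columns $1,\dots,m$ from left to right and rows numbered from the bottom; column $j$ consists of the cells in rows $1,\dots,h_j$, with $h_1\ge\dots\ge h_m\ge1$. The cell in column $j$, row $i$ has corners $(j-1,i-1),(j,i-1),(j-1,i),(j,i)$. Partitions are identified with Ferrers diagrams; $\mu\cup\nu$ is the componentwise maximum. Growth diagrams. Let $G$ be a Ferrers shape with a $0$-$1$-filling having at most one $1$ in each row and each column. Label every corner on the left and bottom sides of $G$ by $\emptyset$ and determine the other labels cell by cell: for a cell with bottom-left label $\rho$, bottom-right $\mu$, top-left $\nu$, the top-right label $\lambda$ is: (F1) if $\rho=\mu=\nu$ and the cell contains $0$, $\lambda=\rho$; (F2) if $\rho=\mu\ne\nu$, $\lambda=\nu$; (F3) if $\rho=\nu\ne\mu$, $\lambda=\mu$; (F4) if $\rho,\mu,\nu$ are pairwise distinct, $\lambda=\mu\cup\nu$; (F5) if $\rho\ne\mu=\nu$ and $\mu,\rho$ differ in row $k$, $\lambda$ is $\mu$ with a square added in row $k+1$; (F6) if $\rho=\mu=\nu$ and the cell contains $1$, $\lambda$ is $\rho$ with a square added to the first row. Dual RSK'. Given a filling of $F$ with non-negative integers, let $c_j$ be the sum of entries in column $j$ and $r_i$ the sum in row $i$. Replace each entry $m$ of a cell by $m$ units $u_1,\dots,u_m$. Build a Ferrers shape $G$ by replacing column $j$ by a block of $\max(c_j,1)$ columns and row $i$ by a block of $\max(r_i,1)$ rows, a cell of $G$ in column block $j$ and row block $i$ belonging to $G$ iff cell (column $j$, row $i$)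 belongs to $F$. The units of column $j$, listed by cells from top to bottom and within a cell as $u_1,\dots,u_m$, are assigned to the columns of block $j$ from left to right; the units of row $i$, listed by cells from left to right and within a cell as $u_1,\dots,u_m$, are assigned to the rows of block $i$ from top to bottom. Each unit becomes a $1$ in the cell of $G$ given by its assigned column and row (so all separations go from top-left to bottom-right). Compute the growth diagram of $G$; the label of corner $(x,y)$ of $F$ is the label of the corner of $G$ at the right end of column block $x$ and the top end of row block $y$. Chains: an ne-chain is a sequence of cells with nonzero entries, each strictly above and strictly to the right of the preceding one; its length is the number of its cells. An SE-chain is a sequence of distinct cells with nonzero entries, each weakly below and weakly to the right of the preceding one; its length is the sum of its entries. *)

theory Defs
  imports "HOL-Library.Multiset"
begin

text \<open>A cell is a pair (column, row), both numbered from 1; a corner is a pair (x, y).\<close>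

type_synonym cell = "nat \<times> nat"

definition ferrers_shape :: "cell set \<Rightarrow> bool" where
  "ferrers_shape F \<longleftrightarrow>
     (\<exists>(m::nat) (h::nat \<Rightarrow> nat).
        (\<forall>j. 1 \<le> j \<and> j \<le> m \<longrightarrow> 1 \<le> h j) \<and>
        (\<forall>j j'. 1 \<le> j \<and> j \<le> j' \<and> j' \<le> m \<longrightarrow> h j' \<le> h j) \<and>
        F = {(j, i). 1 \<le> j \<and> j \<le> m \<and> 1 \<le> i \<and> i \<le> h j})"

definition cell_corners :: "cell \<Rightarrow> (nat \<times> nat) set" where
  "cell_corners = (\<lambda>(j, i). {(j - 1, i - 1), (j, i - 1), (j - 1, i), (j, i)})"

definition corners :: "cell set \<Rightarrow> (nat \<times> nat) set" where
  "corners F = (\<Union>z\<in>F. cell_corners z)"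

text \<open>A partition is the function sending each \<open>i \<ge> 1\<close> to its \<open>i\<close>-th part,
  with 0 for all further parts and, by convention, at index 0.\<close>

type_synonym ptn = "nat \<Rightarrow> nat"

definition is_partition :: "ptn \<Rightarrow> bool" where
  "is_partition p \<longleftrightarrow> p 0 = 0 \<and> (\<forall>i\<ge>1. p (Suc i) \<le> p i) \<and> finite {i. p i \<noteq> 0}"

definition empty_ptn :: ptn where
  "empty_ptn = (\<lambda>_. 0)"

definition union_ptn :: "ptn \<Rightarrow> ptn \<Rightarrow> ptn" where
  "union_ptn p q = (\<lambda>i. max (p i) (q i))"

definition add_square :: "ptn \<Rightarrow> nat \<Rightarrow> ptn" where
  "add_square p k = p(k := p k + 1)"

definition conjugate :: "ptn \<Rightarrow> ptn" where
  "conjugate p = (\<lambda>j. if j = 0 then 0 else card {i. 1 \<le> i \<and> j \<le> p i})"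

text \<open>The branches are, in order, the rules (F6), (F1), (F2), (F3), (F5), (F4);
  the first argument says whether the cell contains a 1.\<close>

definition local_rule :: "bool \<Rightarrow> ptn \<Rightarrow> ptn \<Rightarrow> ptn \<Rightarrow> ptn" where
  "local_rule one \<rho> \<mu> \<nu> =
     (if \<rho> = \<mu> \<and> \<rho> = \<nu> then (if one then add_square \<rho> 1 else \<rho>)
      else if \<rho> = \<mu> then \<nu>
      else if \<rho> = \<nu> then \<mu>
      else if \<mu> = \<nu> then add_square \<mu> (Suc (THE k. \<mu> k \<noteq> \<rho> k))
      else union_ptn \<mu> \<nu>)"

text \<open>The 0-1-filling of the shape \<open>G\<close> is given by the set \<open>X\<close> of its cells containing a 1.
  The value \<^const>\<open>empty_ptn\<close> at points that are not corners of \<open>G\<close> is a dummy.\<close>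

fun growth_label :: "cell set \<Rightarrow> cell set \<Rightarrow> nat \<Rightarrow> nat \<Rightarrow> ptn" where
  "growth_label G X 0 y = empty_ptn"
| "growth_label G X (Suc x) 0 = empty_ptn"
| "growth_label G X (Suc x) (Suc y) =
     (if (Suc x, Suc y) \<in> G
      then local_rule ((Suc x, Suc y) \<in> X)
             (growth_label G X x y) (growth_label G X (Suc x) y) (growth_label G X x (Suc y))
      else empty_ptn)"

definition col_sum :: "cell set \<Rightarrow> (cell \<Rightarrow> nat) \<Rightarrow> nat \<Rightarrow> nat" where
  "col_sum F f j = (\<Sum>i | (j, i) \<in> F. f (j, i))"

definition row_sum :: "cell set \<Rightarrow> (cell \<Rightarrow> nat) \<Rightarrow> nat \<Rightarrow> nat" where
  "row_sum F f i = (\<Sum>j | (j, i) \<in> F. f (j, i))"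

text \<open>Column block \<open>j\<close> consists of the columns \<open>a\<close> with
  \<open>col_end F f (j - 1) < a \<le> col_end F f j\<close>, and similarly for row blocks.\<close>

definition col_end :: "cell set \<Rightarrow> (cell \<Rightarrow> nat) \<Rightarrow> nat \<Rightarrow> nat" where
  "col_end F f x = (\<Sum>j=1..x. max (col_sum F f j) 1)"

definition row_end :: "cell set \<Rightarrow> (cell \<Rightarrow> nat) \<Rightarrow> nat \<Rightarrow> nat" where
  "row_end F f y = (\<Sum>i=1..y. max (row_sum F f i) 1)"

definition blowup_shape :: "cell set \<Rightarrow> (cell \<Rightarrow> nat) \<Rightarrow> cell set" where
  "blowup_shape F f =
     {(a, b). \<exists>j i. (j, i) \<in> F \<and> col_end F f (j - 1) < a \<and> a \<le> col_end F f j
                            \<and> row_end F f (i - 1) < b \<and> b \<le> row_end F f i}"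

text \<open>The positions of the \<open>t\<close>-th unit of the cell \<open>(j, i)\<close>. In its column the units of the
  higher cells precede it and the block is filled from left to right; in its row the units of
  the cells further left precede it and the block is filled from the top row
  \<open>row_end F f i\<close> downwards.\<close>

definition unit_col :: "cell set \<Rightarrow> (cell \<Rightarrow> nat) \<Rightarrow> nat \<Rightarrow> nat \<Rightarrow> nat \<Rightarrow> nat" where
  "unit_col F f j i t = col_end F f (j - 1) + ((\<Sum>i' | (j, i') \<in> F \<and> i < i'. f (j, i')) + t)"

definition unit_row :: "cell set \<Rightarrow> (cell \<Rightarrow> nat) \<Rightarrow> nat \<Rightarrow> nat \<Rightarrow> nat \<Rightarrow> nat" where
  "unit_row F f j i t = row_end F f i + 1 - ((\<Sum>j' | (j', i) \<in> F \<and> j' < j. f (j', i)) + t)"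

definition blowup_ones :: "cell set \<Rightarrow> (cell \<Rightarrow> nat) \<Rightarrow> cell set" where
  "blowup_ones F f =
     {(unit_col F f j i t, unit_row F f j i t) | j i t. (j, i) \<in> F \<and> 1 \<le> t \<and> t \<le> f (j, i)}"

definition dual_rsk'_label :: "cell set \<Rightarrow> (cell \<Rightarrow> nat) \<Rightarrow> nat \<Rightarrow> nat \<Rightarrow> ptn" where
  "dual_rsk'_label F f x y =
     growth_label (blowup_shape F f) (blowup_ones F f) (col_end F f x) (row_end F f y)"

definition region :: "cell set \<Rightarrow> nat \<Rightarrow> nat \<Rightarrow> cell set" where
  "region F x y = {(j, i). (j, i) \<in> F \<and> j \<le> x \<and> i \<le> y}"

text \<open>The empty sequence counts as a chain, so that collections of \<open>k\<close> chains exist for all \<open>k\<close>.\<close>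

definition ne_chain :: "(cell \<Rightarrow> nat) \<Rightarrow> cell set \<Rightarrow> cell list \<Rightarrow> bool" where
  "ne_chain f R C \<longleftrightarrow> set C \<subseteq> R \<and> (\<forall>z\<in>set C. f z \<noteq> 0) \<and>
     successively (\<lambda>(j, i) (j', i'). j < j' \<and> i < i') C"

definition SE_chain :: "(cell \<Rightarrow> nat) \<Rightarrow> cell set \<Rightarrow> cell list \<Rightarrow> bool" where
  "SE_chain f R C \<longleftrightarrow> set C \<subseteq> R \<and> (\<forall>z\<in>set C. f z \<noteq> 0) \<and> distinct C \<and>
     successively (\<lambda>(j, i) (j', i'). j \<le> j' \<and> i' \<le> i) C"

definition ne_length :: "cell list \<Rightarrow> nat" where
  "ne_length C = length C"

definition SE_length :: "(cell \<Rightarrow> nat) \<Rightarrow> cell list \<Rightarrow> nat" where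
  "SE_length f C = (\<Sum>z\<leftarrow>C. f z)"

definition ne_collection :: "(cell \<Rightarrow> nat) \<Rightarrow> cell set \<Rightarrow> nat \<Rightarrow> cell list list \<Rightarrow> bool" where
  "ne_collection f R k Cs \<longleftrightarrow> length Cs = k \<and> (\<forall>C\<in>set Cs. ne_chain f R C) \<and>
     (\<forall>z\<in>R. card {n. n < k \<and> z \<in> set (Cs ! n)} \<le> f z)"

definition SE_collection :: "(cell \<Rightarrow> nat) \<Rightarrow> cell set \<Rightarrow> nat \<Rightarrow> cell list list \<Rightarrow> bool" where
  "SE_collection f R k Cs \<longleftrightarrow> length Cs = k \<and> (\<forall>C\<in>set Cs. SE_chain f R C) \<and>
     (\<forall>n<k. \<forall>n'<k. n \<noteq> n' \<longrightarrow> set (Cs ! n) \<inter> set (Cs ! n') = {})"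

definition is_maximum :: "nat set \<Rightarrow> nat \<Rightarrow> bool" where
  "is_maximum S N \<longleftrightarrow> N \<in> S \<and> (\<forall>s\<in>S. s \<le> N)"

end

theory Submission
  imports Defs
begin

text \<open>
  The proof is Greene's theorem for the permutation of the units, carried out inside the growth
  diagram. Reading the labels along the vertical line at \<open>x\<close> upwards gives a standard tableau on the
  heights of the points to the left of the line, and passing to the line \<open>x + 1\<close> is row insertion.
  Undoing one bump preserves the maximal sizes of \<open>k\<close>-families of increasing and of decreasing
  subsequences from below (exchange of tails), so the rows and columns of the final tableau yield
  families of \<open>k\<close> increasing chains with \<open>\<lambda>\<^sub>1 + \<dots> + \<lambda>\<^sub>k\<close> points and of \<open>l\<close> decreasing chains with
  \<open>\<lambda>'\<^sub>1 + \<dots> + \<lambda>'\<^sub>l\<close> points. An increasing and a decreasing chain share at most one point, so such families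
  have together at most \<open>n + k l\<close> points; this is attained when \<open>(k, l)\<close> is on the boundary of
  \<open>\<lambda>\<close>, hence both lower bounds are sharp.

  Two units are strictly north-east comparable iff their cells are. Units of one cell are never
  comparable, so in families of SE-chains every cell may be used completely.
\<close>

section \<open>Families of chains as colourings\<close>

text \<open>A family of chains is stored as a colouring of the set of its points, so its size is a
  cardinality and only pairs within a class must be checked. Words are replaced by position
  functions: a whole tableau row shares one position, its letters being read in increasing order. A
  bump then changes just two positions and needs no factorisation into elementary Knuth relations.
  The price is that undoing it can break one class, which is repaired by replacing a letter or by
  recombining two classes. Row insertion is visible in the edge labels. Going up a column of cells,
  the label of the top edge is 0 below the point, becomes 1 at the point, and grows by one exactly
  at those heights whose left edge carries the same label. Such a height stood in that row, directly
  above (in value) the height that has just entered it, and is bumped to the next row.\<close>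

definition colourable :: "('a \<Rightarrow> 'a \<Rightarrow> bool) \<Rightarrow> nat \<Rightarrow> 'a set \<Rightarrow> bool" where
  "colourable Q k S \<longleftrightarrow>
     (\<exists>c. (\<forall>a\<in>S. c a < k) \<and> (\<forall>a\<in>S. \<forall>b\<in>S. a \<noteq> b \<and> c a = c b \<longrightarrow> Q a b))"

text \<open>A permutation is given by the position \<open>p a\<close> of each letter \<open>a\<close>, where larger positions are
  further to the left: \<open>up\<close> and \<open>down\<close> describe increasing and decreasing subsequences. Letters
  in equal position are meant to be listed in increasing order.\<close>

definition up :: "(nat \<Rightarrow> int) \<Rightarrow> nat \<Rightarrow> nat \<Rightarrow> bool" where
  "up p a b \<longleftrightarrow> (a < b \<longrightarrow> p b \<le> p a)"

definition down :: "(nat \<Rightarrow> int) \<Rightarrow> nat \<Rightarrow> nat \<Rightarrow> bool" where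
  "down p a b \<longleftrightarrow> (a < b \<longrightarrow> p a < p b)"

text \<open>The witness \<open>T\<close> may differ from \<open>S\<close>, since undoing a bump can
  exchange one letter for another; only cardinalities are transported from \<open>p'\<close> to
  \<open>p\<close>.\<close>

definition dominated :: "nat set \<Rightarrow> (nat \<Rightarrow> int) \<Rightarrow> (nat \<Rightarrow> int) \<Rightarrow> bool" where
  "dominated H p' p \<longleftrightarrow>
     (\<forall>k S. S \<subseteq> H \<longrightarrow>
        (colourable (up p') k S \<longrightarrow> (\<exists>T\<subseteq>H. card T = card S \<and> colourable (up p) k T)) \<and>
        (colourable (down p') k S \<longrightarrow> (\<exists>T\<subseteq>H. card T = card S \<and> colourable (down p) k T)))"

lemma colourable_mono:
  assumes "colourable Q k S" "T \<subseteq> S"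
    and "\<And>a b. a \<in> T \<Longrightarrow> b \<in> T \<Longrightarrow> a \<noteq> b \<Longrightarrow> Q a b \<Longrightarrow> Q' a b"
  shows "colourable Q' k T"
proof -
  obtain c where c: "\<forall>a\<in>S. c a < k" "\<forall>a\<in>S. \<forall>b\<in>S. a \<noteq> b \<and> c a = c b \<longrightarrow> Q a b"
    using assms(1) unfolding colourable_def by blast
  show ?thesis
    unfolding colourable_def using c assms(2,3) by (intro exI[of _ c]) blast
qed

lemma colourable_image:
  assumes "colourable Q k S" "inj_on g S"
    and "\<And>a b. a \<in> S \<Longrightarrow> b \<in> S \<Longrightarrow> a \<noteq> b \<Longrightarrow> Q a b \<Longrightarrow> Q' (g a) (g b)"
  shows "colourable Q' k (g ` S)"
proof -
  obtain c where c: "\<forall>a\<in>S. c a < k" "\<forall>a\<in>S. \<forall>b\<in>S. a \<noteq> b \<and> c a = c b \<longrightarrow> Q a b"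
    using assms(1) unfolding colourable_def by blast
  have inv: "inv_into S g (g a) = a" if "a \<in> S" for a
    using that assms(2) by simp
  show ?thesis
    unfolding colourable_def
    by (intro exI[of _ "c \<circ> inv_into S g"]) (use c assms(3) inv in \<open>simp, metis\<close>)
qed

lemma colourable_inverse_image:
  assumes "colourable Q k (g ` S)" "inj_on g S"
    and "\<And>a b. a \<in> S \<Longrightarrow> b \<in> S \<Longrightarrow> a \<noteq> b \<Longrightarrow> Q (g a) (g b) \<Longrightarrow> Q' a b"
  shows "colourable Q' k S"
proof -
  have "colourable Q' k (inv_into S g ` g ` S)"
    using assms(2,3) by (intro colourable_image[OF assms(1)] inj_on_inv_into) (auto, metis)
  then show ?thesis using assms(2) by simp
qed

lemma dominated_up:
  assumes "dominated H p' p" "S \<subseteq> H" "colourable (up p') k S"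
  shows "\<exists>T\<subseteq>H. card T = card S \<and> colourable (up p) k T"
  using assms unfolding dominated_def by simp

lemma dominated_down:
  assumes "dominated H p' p" "S \<subseteq> H" "colourable (down p') k S"
  shows "\<exists>T\<subseteq>H. card T = card S \<and> colourable (down p) k T"
  using assms unfolding dominated_def by simp

lemma dominated_refl: "dominated H p p"
  unfolding dominated_def by blast

lemma dominated_trans: "dominated H p q \<Longrightarrow> dominated H q r \<Longrightarrow> dominated H p r"
  unfolding dominated_def by (intro allI impI conjI) (metis (no_types))+

text \<open>Both \<open>up\<close> and \<open>down\<close> depend only on strict comparisons from a
  smaller to a larger letter, so positions may be renumbered as long as these survive.\<close>

lemma dominated_same_order:
  assumes "\<And>a b. a \<in> H \<Longrightarrow> b \<in> H \<Longrightarrow> a < b \<Longrightarrow> p a < p b \<longleftrightarrow> q a < q b"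
  shows "dominated H p q"
  unfolding dominated_def
proof (intro allI impI conjI)
  fix k S assume S: "S \<subseteq> H"
  { assume "colourable (up p) k S"
    then have "colourable (up q) k S"
      by (rule colourable_mono[OF _ subset_refl])
        (use assms S in \<open>fastforce simp: up_def not_less[symmetric]\<close>)
    then show "\<exists>T\<subseteq>H. card T = card S \<and> colourable (up q) k T" using S by blast }
  { assume "colourable (down p) k S"
    then have "colourable (down q) k S"
      by (rule colourable_mono[OF _ subset_refl]) (use assms S in \<open>fastforce simp: down_def\<close>)
    then show "\<exists>T\<subseteq>H. card T = card S \<and> colourable (down q) k T" using S by blast }
qed

section \<open>Undoing a bump\<close>

text \<open>Before the bump the letter \<open>x\<close> stands to the right of row \<open>R\<close>; afterwards it has taken the
  place of \<open>z\<close>, the first larger letter of that row, and \<open>z\<close> stands to the left of the row.\<close>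

locale bump =
  fixes H :: "nat set" and p p' :: "nat \<Rightarrow> int" and R :: int and x z :: nat
  assumes fin: "finite H" and xH: "x \<in> H" and zH: "z \<in> H" and xz: "x < z"
    and px: "p x = R - 1" and pz: "p z = R" and px': "p' x = R" and pz': "p' z = R + 1"
    and same: "\<And>a. a \<in> H \<Longrightarrow> a \<noteq> x \<Longrightarrow> a \<noteq> z \<Longrightarrow> p' a = p a"
    and free: "\<And>a. a \<in> H \<Longrightarrow> a \<noteq> x \<Longrightarrow> a \<noteq> z \<Longrightarrow> p a \<noteq> R - 1 \<and> p a \<noteq> R + 1"
    and first: "\<And>a. a \<in> H \<Longrightarrow> x < a \<Longrightarrow> a < z \<Longrightarrow> p a \<noteq> R"
begin

lemma kinds:
  assumes "a \<in> H"
  shows "a = x \<and> p a = R - 1 \<and> p' a = R \<or> a = z \<and> p a = R \<and> p' a = R + 1 \<or>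
    a \<noteq> x \<and> a \<noteq> z \<and> p' a = p a \<and> p a \<noteq> R - 1 \<and> p a \<noteq> R + 1 \<and> (a \<le> x \<or> z \<le> a \<or> p a \<noteq> R)"
proof (cases "a = x \<or> a = z")
  case True
  then show ?thesis using px pz px' pz' by blast
next
  case False
  then show ?thesis using same[OF assms] free[OF assms] first[OF assms] by (meson not_le)
qed

lemma transfer_up:
  assumes S: "S \<subseteq> H" and col: "colourable (up p') k S"
  shows "\<exists>T\<subseteq>H. card T = card S \<and> colourable (up p) k T"
proof -
  obtain c where ck: "\<And>a. a \<in> S \<Longrightarrow> c a < k"
    and c: "\<And>a b. a \<in> S \<Longrightarrow> b \<in> S \<Longrightarrow> a < b \<Longrightarrow> c a = c b \<Longrightarrow> p' b \<le> p' a"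
    using col unfolding colourable_def up_def by (metis less_irrefl)
  have finS: "finite S" using S fin finite_subset by blast
  have viol: "a = x \<and> p b = R \<and> z < b"
    if "a \<in> S" "b \<in> S" "a < b" "p' b \<le> p' a" "p a < p b" for a b
  proof -
    have "a \<in> H" "b \<in> H" using that S by auto
    then show ?thesis
      using that kinds[OF \<open>a \<in> H\<close>] kinds[OF \<open>b \<in> H\<close>] xz by (elim disjE) auto
  qed
  show ?thesis
  proof (cases "x \<in> S \<and> (\<exists>b\<in>S. c b = c x \<and> p b = R \<and> z < b)")
    case False
    have "colourable (up p) k S"
      unfolding colourable_def up_def
    proof (intro exI[of _ c] conjI ballI impI)
      fix a b assume "a \<in> S" "b \<in> S" "a \<noteq> b \<and> c a = c b" "a < b"
      then show "p b \<le> p a"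
        using c[of a b] viol[of a b] False by force
    qed (use ck in auto)
    then show ?thesis using S by blast
  next
    case True
    then have xS: "x \<in> S" by blast
    obtain b0 where b0: "b0 \<in> S" "c b0 = c x" "p b0 = R" "z < b0" using True by blast
    have b0': "p' b0 = R" using same[of b0] b0 S xz by auto
    show ?thesis
    proof (cases "z \<in> S")
      case False
      define T where "T = insert z (S - {x})"
      define d where "d = c(z := c x)"
      have "card T = card S"
        unfolding T_def using False card_Suc_Diff1[OF finS xS] finS by simp
      moreover have "T \<subseteq> H" unfolding T_def using S zH by auto
      moreover have "colourable (up p) k T"
        unfolding colourable_def
      proof (intro exI[of _ d] conjI ballI impI)
        fix a assume "a \<in> T" then show "d a < k" unfolding T_def d_def using ck xS by auto
      next
        fix a b assume ab: "a \<in> T" "b \<in> T" "a \<noteq> b \<and> d a = d b"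
        show "up p a b" unfolding up_def
        proof
          assume lt: "a < b"
          show "p b \<le> p a"
          proof (cases "a = z")
            case True
            then have b: "b \<in> S" "c b = c x" "b \<noteq> z" "b \<noteq> x" using ab lt unfolding T_def d_def by auto
            have "p' b \<le> p' x" using c[of x b] b xS xz lt True by auto
            then show ?thesis using True pz px' same[of b] b S by auto
          next
            case az: False
            then have a: "a \<in> S" "a \<noteq> x" using ab unfolding T_def by auto
            have pa: "p' a = p a" using same a az S by auto
            show ?thesis
            proof (cases "b = z")
              case True
              then have ca: "c a = c x" using ab az unfolding d_def by auto
              \<comment> \<open>Letters below \<open>x\<close> are bounded by \<open>x\<close>; for
                those between \<open>x\<close> and \<open>z\<close> the witness \<open>b0\<close> of
                the broken pair gives the bound.\<close>
              have "p a \<ge> R"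
              proof (cases "a < x")
                case True then show ?thesis using c[of a x] a xS ca px' pa by auto
              next
                case False
                then show ?thesis using c[of a b0] a b0 ca lt b0' pa \<open>b = z\<close> by auto
              qed
              then show ?thesis using True pz by auto
            next
              case False
              then have b: "b \<in> S" "b \<noteq> x" using ab unfolding T_def by auto
              then show ?thesis using c[of a b] a lt ab az False pa same[of b] S unfolding d_def by auto
            qed
          qed
        qed
      qed
      ultimately show ?thesis by blast
    next
      case zS: True
      have cne: "c x \<noteq> c z" using c[of x z] xS zS xz px' pz' by auto
      \<comment> \<open>All letters of row \<open>R\<close> beyond \<open>z\<close> join the class of \<open>z\<close>, followed by the tail of the class
        that contained the largest of them; the class of \<open>x\<close> gets the other tail.\<close>
      define A where "A = {a \<in> S. (c a = c x \<or> c a = c z) \<and> p a = R \<and> z < a}"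
      have finA: "finite A" and A0: "A \<noteq> {}" using finS b0 unfolding A_def by auto
      define M where "M = Max A"
      have MA: "M \<in> A" and Mmax: "\<And>a. a \<in> A \<Longrightarrow> a \<le> M"
        unfolding M_def using finA A0 by auto
      define B where "B = {a \<in> S. (c a = c x \<and> x < a \<or> c a = c z \<and> z < a) \<and> p a < R}"
      define d where "d a = (if a \<in> A then c z
          else if a \<in> B \<and> c M = c x then (if c a = c x then c z else c x) else c a)" for a
      have M': "p' M = R" using MA same[of M] S xz unfolding A_def by auto
      have MS: "M \<in> S" "p M = R" "z < M" "c M = c x \<or> c M = c z" using MA unfolding A_def by auto
      have B: "b \<in> S \<and> p b < R \<and> x < b \<and> b \<noteq> z \<and> p' b = p b" if "b \<in> B" for b
        using that same[of b] S pz xz unfolding B_def by auto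
      \<comment> \<open>The tail attached after the row letters comes from the class of
        \<open>M\<close>; a letter of it below \<open>M\<close> would have to stand weakly left of
        \<open>M\<close>, but its position is less than \<open>R\<close>.\<close>
      have BM: "M < b" if "b \<in> B" "d b = c z" for b
      proof (rule ccontr)
        assume "\<not> M < b"
        moreover have "b \<noteq> M" using that MS unfolding B_def by auto
        ultimately have "b < M" by auto
        moreover have "c b = c M" using that MS cne unfolding B_def A_def d_def
          by (auto split: if_splits)
        ultimately have "p' M \<le> p' b" using c[of b M] that MS B by auto
        then show False using M' B[OF that(1)] by auto
      qed
      have dx: "d x = c x" and dz: "d z = c z"
        unfolding d_def A_def B_def using xz cne pz by auto
      \<comment> \<open>Whatever remains of the two classes comes before \<open>x\<close> or
        \<open>z\<close>: in the class of \<open>x\<close>, a letter above \<open>x\<close> at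
        position \<open>R\<close> cannot lie below \<open>z\<close> by \<open>first\<close>, so it
        is in \<open>A\<close>.\<close>
      have cls: "a \<in> A \<or> a \<in> B \<or> (a = x \<or> a = z) \<or>
           (d a = c a \<and> (c a = c x \<longrightarrow> a < x \<and> p a \<ge> R) \<and> (c a = c z \<longrightarrow> a < z \<and> p a \<ge> R + 1))"
        if "a \<in> S" for a
      proof (cases "a \<in> A \<or> a \<in> B \<or> a = x \<or> a = z")
        case True then show ?thesis by blast
      next
        case False
        have aH: "p' a = p a" "p a \<noteq> R - 1" "p a \<noteq> R + 1" using same[of a] free[of a] False that S by auto
        have dd: "d a = c a" using False unfolding d_def by auto
        moreover have "a < x \<and> p a \<ge> R" if ca: "c a = c x"
        proof (cases "a < x")
          case True then show ?thesis using c[of a x] \<open>a \<in> S\<close> xS ca aH px' by auto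
        next
          case f: False
          then have "x < a" using False by auto
          then have "p a \<le> R" using c[of x a] \<open>a \<in> S\<close> xS ca aH px' by auto
          moreover have "\<not> p a < R" using False \<open>x < a\<close> ca \<open>a \<in> S\<close> unfolding B_def by auto
          ultimately have "p a = R" by auto
          moreover have "z < a" using first[of a] \<open>x < a\<close> \<open>p a = R\<close> S \<open>a \<in> S\<close> False by force
          ultimately show ?thesis using False ca \<open>a \<in> S\<close> unfolding A_def by auto
        qed
        moreover have "a < z \<and> p a \<ge> R + 1" if ca: "c a = c z"
        proof (cases "a < z")
          case True then show ?thesis using c[of a z] \<open>a \<in> S\<close> zS ca aH pz' by auto
        next
          case f: False
          then have "z < a" using False by auto
          then have "p a \<le> R" using c[of z a] \<open>a \<in> S\<close> zS ca aH pz' by auto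
          moreover have "\<not> p a < R" using False \<open>z < a\<close> ca \<open>a \<in> S\<close> unfolding B_def by auto
          ultimately show ?thesis using False ca \<open>a \<in> S\<close> \<open>z < a\<close> unfolding A_def by auto
        qed
        ultimately show ?thesis by blast
      qed
      have Bd: "d b = c x \<or> d b = c z" if "b \<in> B" for b
        using that unfolding d_def B_def by auto
      have Ad: "d b = c z" if "b \<in> A" for b
        using that unfolding d_def by auto
      have AA: "p b = R \<and> z < b" if "b \<in> A" for b using that unfolding A_def by auto
      have BB: "p' b \<le> p' a" if "a \<in> B" "b \<in> B" "d a = d b" "a < b" for a b
      proof -
        have "c a = c b" using that MS cne unfolding d_def B_def A_def by (auto split: if_splits)
        then show ?thesis using c[of a b] B[of a] B[of b] that by blast
      qed
      have lowx: "a \<in> B \<or> a = x \<or> a < x \<and> R \<le> p a \<and> c a = c x" if "a \<in> S" "d a = c x" for a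
        using cls[OF that(1)] that(2) Ad[of a] dz cne by metis
      have lowz: "a \<in> B \<and> M < a \<or> a \<in> A \<or> a = z \<or> a < z \<and> R + 1 \<le> p a \<and> c a = c z"
        if "a \<in> S" "d a = c z" for a
        using cls[OF that(1)] that(2) BM[of a] dx cne by metis
      have "colourable (up p) k S"
        unfolding colourable_def
      proof (intro exI[of _ d] conjI ballI impI)
        fix a assume "a \<in> S" then show "d a < k" unfolding d_def using ck xS zS by auto
      next
        fix a b assume ab: "a \<in> S" "b \<in> S" "a \<noteq> b \<and> d a = d b"
        show "up p a b" unfolding up_def
        proof
          assume lt: "a < b"
          show "p b \<le> p a"
          proof (cases "d a = c x \<or> d a = c z")
            case False
            then have n: "a \<noteq> x" "a \<noteq> z" "b \<noteq> x" "b \<noteq> z" "a \<notin> A" "b \<notin> A" "a \<notin> B" "b \<notin> B"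
              using dx dz Bd Ad ab(3) by metis+
            then have "c a = c b" using ab unfolding d_def by auto
            then have "p' b \<le> p' a" using c[OF ab(1,2) lt] by blast
            moreover have "p' a = p a" "p' b = p b" using same n ab S by blast+
            ultimately show ?thesis by simp
          next
            case True
            then show ?thesis
            proof
              assume da: "d a = c x"
              then have db: "d b = c x" using ab by simp
              from lowx[OF ab(1) da] consider "a \<in> B" | "a = x" | "a < x" "R \<le> p a" "c a = c x" by blast
              then show ?thesis
              proof cases
                case 1
                then have "b \<in> B" using lowx[OF ab(2) db] B[OF 1] lt by force
                then show ?thesis using BB[of a b] 1 ab lt B by metis
              next
                case 2
                then have "b \<in> B" using lowx[OF ab(2) db] lt by force
                then show ?thesis using B[of b] 2 px by force
              next
                case 3
                show ?thesis
                proof (cases "b \<in> B \<or> b = x")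
                  case True then show ?thesis using 3 B[of b] px by force
                next
                  case False
                  then have b: "b < x" "c b = c x" using lowx[OF ab(2) db] by auto
                  then have "p' b \<le> p' a" using c[OF ab(1,2) lt] 3 by simp
                  moreover have "p' a = p a" "p' b = p b" using same[of a] same[of b] 3 b xz ab S by auto
                  ultimately show ?thesis by simp
                qed
              qed
            next
              assume da: "d a = c z"
              then have db: "d b = c z" using ab by simp
              from lowz[OF ab(1) da] consider "a \<in> B" "M < a" | "a \<in> A" | "a = z"
                | "a < z" "R + 1 \<le> p a" "c a = c z" by blast
              then show ?thesis
              proof cases
                case 1
                then have "b \<in> B" using lowz[OF ab(2) db] Mmax[of b] MS lt by force
                then show ?thesis using BB[of a b] 1 ab lt B by metis
              next
                case 2
                then have "b \<in> A \<or> b \<in> B" using lowz[OF ab(2) db] AA[OF 2] lt by force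
                then show ?thesis using B[of b] AA[of b] AA[OF 2] by force
              next
                case 3
                then have "b \<in> A \<or> b \<in> B" using lowz[OF ab(2) db] lt by force
                then show ?thesis using B[of b] AA[of b] 3 pz by force
              next
                case 4
                show ?thesis
                proof (cases "b \<in> B \<or> b \<in> A \<or> b = z")
                  case True then show ?thesis using 4 B[of b] AA[of b] pz by force
                next
                  case False
                  then have b: "b < z" "c b = c z" using lowz[OF ab(2) db] by auto
                  then have "p' b \<le> p' a" using c[OF ab(1,2) lt] 4 by simp
                  moreover have "p' a = p a" "p' b = p b"
                    using same[of a] same[of b] 4 b cne ab S by auto
                  ultimately show ?thesis by simp
                qed
              qed
            qed
          qed
        qed
      qed
      then show ?thesis using S by blast
    qed
  qed
qed

lemma transfer_down:
  assumes S: "S \<subseteq> H" and col: "colourable (down p') k S"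
  shows "\<exists>T\<subseteq>H. card T = card S \<and> colourable (down p) k T"
proof -
  obtain c where ck: "\<And>a. a \<in> S \<Longrightarrow> c a < k"
    and c: "\<And>a b. a \<in> S \<Longrightarrow> b \<in> S \<Longrightarrow> a < b \<Longrightarrow> c a = c b \<Longrightarrow> p' a < p' b"
    using col unfolding colourable_def down_def by (metis less_irrefl)
  have finS: "finite S" using S fin finite_subset by blast
  have viol: "b = z \<and> p a = R \<and> a < x"
    if "a \<in> S" "b \<in> S" "a < b" "p' a < p' b" "p b \<le> p a" for a b
  proof -
    have "a \<in> H" "b \<in> H" using that S by auto
    then show ?thesis
      using that kinds[OF \<open>a \<in> H\<close>] kinds[OF \<open>b \<in> H\<close>] xz by (elim disjE) auto
  qed
  show ?thesis
  proof (cases "z \<in> S \<and> (\<exists>a\<in>S. c a = c z \<and> p a = R \<and> a < x)")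
    case False
    have "colourable (down p) k S"
      unfolding colourable_def down_def
    proof (intro exI[of _ c] conjI ballI impI)
      fix a b assume "a \<in> S" "b \<in> S" "a \<noteq> b \<and> c a = c b" "a < b"
      then show "p a < p b"
        using c[of a b] viol[of a b] False by force
    qed (use ck in auto)
    then show ?thesis using S by blast
  next
    case True
    then have zS: "z \<in> S" by blast
    obtain a0 where a0: "a0 \<in> S" "c a0 = c z" "p a0 = R" "a0 < x" using True by blast
    have a0': "p' a0 = R" using same[of a0] a0 S xz by auto
    \<comment> \<open>No integer lies strictly between the positions \<open>R\<close> of
      \<open>a0\<close> and \<open>R + 1\<close> of \<open>z\<close>, so \<open>a0\<close> is the
      next member of the class below \<open>z\<close>; the vacancy of \<open>R - 1\<close> sharpens
      the bound for the others.\<close>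
    have below: "a < a0 \<and> p a < R - 1" if "a \<in> S" "a \<noteq> a0" "a \<noteq> x" "a < z" "c a = c z" for a
    proof -
      have s: "p' a = p a" "p a \<noteq> R - 1" "p a \<noteq> R + 1" using same[of a] free[of a] that S by auto
      have "p a < R + 1" using c[of a z] that zS s pz' by auto
      then have "\<not> a0 < a" using c[of a0 a] that a0 a0' s by auto
      then show ?thesis using c[of a a0] that a0 a0' s by auto
    qed
    have above: "p b > R + 1" if "b \<in> S" "z < b" "c b = c z" for b
      using c[of z b] same[of b] that zS pz' xz S by auto
    show ?thesis
    proof (cases "x \<in> S")
      case False
      define T where "T = insert x (S - {a0})"
      define d where "d = c(x := c z)"
      have "card T = card S"
        unfolding T_def using False card_Suc_Diff1[OF finS a0(1)] finS by simp
      moreover have "T \<subseteq> H" unfolding T_def using S xH by auto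
      moreover have "colourable (down p) k T"
        unfolding colourable_def
      proof (intro exI[of _ d] conjI ballI impI)
        fix a assume "a \<in> T" then show "d a < k" unfolding T_def d_def using ck zS by auto
      next
        fix a b assume ab: "a \<in> T" "b \<in> T" "a \<noteq> b \<and> d a = d b"
        show "down p a b" unfolding down_def
        proof
          assume lt: "a < b"
          show "p a < p b"
          proof (cases "a = x")
            case True
            then have b: "b \<in> S" "c b = c z" "b \<noteq> x" "b \<noteq> a0" using ab lt unfolding T_def d_def by auto
            then show ?thesis using below[of b] above[of b] a0 lt True px pz by (cases b z rule: linorder_cases) auto
          next
            case ax: False
            then have a: "a \<in> S" "a \<noteq> a0" using ab unfolding T_def by auto
            show ?thesis
            proof (cases "b = x")
              case True
              then show ?thesis using below[of a] a ax ab lt px xz unfolding d_def by auto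
            next
              case bx: False
              then have b: "b \<in> S" "b \<noteq> a0" using ab unfolding T_def by auto
              have cc: "c a = c b" using ab ax bx unfolding d_def by auto
              show ?thesis
              proof (rule ccontr)
                assume "\<not> p a < p b"
                then have "b = z \<and> p a = R \<and> a < x"
                  using viol[OF a(1) b(1) lt] c[OF a(1) b(1) lt cc] by auto
                then show False using below[of a] a ax cc xz by auto
              qed
            qed
          qed
        qed
      qed
      ultimately show ?thesis by blast
    next
      case xS: True
      have cne: "c x \<noteq> c z" using c[of a0 x] xS a0 px' a0' by auto
      have belowx: "p a < R - 1" if "a \<in> S" "a < x" "c a = c x" for a
        using c[of a x] same[of a] free[of a] that xS px' xz S by force
      have abovex: "p b > R" if "b \<in> S" "x < b" "c b = c x" for b
        using c[of x b] same[of b] that xS px' cne S by force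
      define d where "d a = (if a \<le> x \<and> c a = c x then c z
          else if a \<le> x \<and> c a = c z then c x else c a)" for a
      have "colourable (down p) k S"
        unfolding colourable_def
      proof (intro exI[of _ d] conjI ballI impI)
        fix a assume "a \<in> S" then show "d a < k" unfolding d_def using ck xS zS by auto
      next
        fix a b assume ab: "a \<in> S" "b \<in> S" "a \<noteq> b \<and> d a = d b"
        show "down p a b" unfolding down_def
        proof
          assume lt: "a < b"
          show "p a < p b"
          proof (cases "c a = c b")
            case True
            have *: "p' a < p' b" using c[OF ab(1,2) lt True] .
            have "\<not> (b = z \<and> p a = R \<and> a < x)"
            proof
              assume h: "b = z \<and> p a = R \<and> a < x"
              then have "d a = c x" "d b = c b" using True cne xz by (simp_all add: d_def)
              then show False using ab h cne by simp
            qed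
            then show ?thesis using viol[OF ab(1,2) lt *] not_le by blast
          next
            case False
            have "a \<le> x"
            proof (rule ccontr)
              assume "\<not> a \<le> x"
              then have "d a = c a" "d b = c b" using lt by (simp_all add: d_def)
              then show False using ab False by simp
            qed
            then have da: "d a = (if c a = c x then c z else if c a = c z then c x else c a)"
              by (simp add: d_def)
            have "x < b"
            proof (rule ccontr)
              assume "\<not> x < b"
              then have "d b = (if c b = c x then c z else if c b = c z then c x else c b)"
                by (simp add: d_def)
              then show False using ab(3) False cne da by metis
            qed
            then have "d b = c b" by (simp add: d_def)
            then consider "c a = c x" "c b = c z" | "c a = c z" "c b = c x"
              using ab(3) False da by metis
            then show ?thesis
            proof cases
              case 1
              have "p a \<le> R - 1" using belowx[of a] 1 ab \<open>a \<le> x\<close> px by (cases "a = x") auto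
              moreover have "p b \<ge> R"
                using below[of b] above[of b] 1 ab \<open>x < b\<close> pz a0 by (cases b z rule: linorder_cases) auto
              ultimately show ?thesis by auto
            next
              case 2
              have "a \<noteq> x" using 2 cne by auto
              then have "p a \<le> R" using below[of a] 2 ab \<open>a \<le> x\<close> xz a0 by (cases "a = a0") auto
              then show ?thesis using abovex[of b] 2 ab \<open>x < b\<close> by auto
            qed
          qed
        qed
      qed
      then show ?thesis using S by blast
    qed
  qed
qed

lemma dominated: "dominated H p' p"
  unfolding dominated_def by (intro allI impI conjI transfer_up transfer_down)

end

section \<open>Growth diagrams\<close>

definition add_box :: "ptn \<Rightarrow> nat \<Rightarrow> ptn" where
  "add_box p k = (if k = 0 then p else add_square p k)"

text \<open>An edge of the growth diagram is labelled by the row in which its two ends differ, and by 0 if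
  they are equal. From the labels \<open>q\<close> of the left and \<open>d\<close> of the bottom edge of a cell, the local
  rules yield those of its right and top edge.\<close>

definition edge_step :: "bool \<Rightarrow> nat \<Rightarrow> nat \<Rightarrow> nat \<times> nat" where
  "edge_step one q d =
     (if q = 0 \<and> d = 0 then (if one then (1, 1) else (0, 0))
      else if q = d then (Suc q, Suc d) else (q, d))"

text \<open>The pair at \<open>(x, a)\<close> labels the right and the top edge of the cell with
  that upper right corner; the zeros reflect the empty partitions on the left and bottom
  sides.\<close>

fun edges :: "cell set \<Rightarrow> nat \<Rightarrow> nat \<Rightarrow> nat \<times> nat" where
  "edges P 0 a = (0, 0)"
| "edges P (Suc x) 0 = (0, 0)"
| "edges P (Suc x) (Suc a) =
     edge_step ((Suc x, Suc a) \<in> P) (fst (edges P x (Suc a))) (snd (edges P (Suc x) a))"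

lemma add_square_neq: "add_square p k \<noteq> p" "p \<noteq> add_square p k"
  unfolding add_square_def by (metis fun_upd_same n_not_Suc_n Suc_eq_plus1)+

lemma add_square_eq_iff: "add_square p k = add_square p l \<longleftrightarrow> k = l"
proof
  assume "add_square p k = add_square p l"
  then have "add_square p k k = add_square p l k" by simp
  then show "k = l" unfolding add_square_def by (simp split: if_splits)
qed simp

text \<open>The new label is reached both from the bottom right and from the top left. In (F4),
  adding squares in two different rows commutes and the union is the common result; in (F5),
  \<open>THE\<close> recovers the row of the square just added.\<close>

lemma local_rule_edge_step:
  shows "local_rule one p (add_box p d) (add_box p q) = add_box (add_box p d) (fst (edge_step one q d))"
    and "local_rule one p (add_box p d) (add_box p q) = add_box (add_box p q) (snd (edge_step one q d))"
proof -
  have the: "(THE k. add_square p e k \<noteq> p k) = e" for e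
    by (rule the_equality) (auto simp: add_square_def split: if_splits)
  have comm: "union_ptn (add_square p d) (add_square p q) = add_square (add_square p d) q"
    "add_square (add_square p d) q = add_square (add_square p q) d" if "d \<noteq> q"
    using that by (auto simp: union_ptn_def add_square_def fun_eq_iff)
  show "local_rule one p (add_box p d) (add_box p q) = add_box (add_box p d) (fst (edge_step one q d))"
    "local_rule one p (add_box p d) (add_box p q) = add_box (add_box p q) (snd (edge_step one q d))"
    by (auto simp: local_rule_def add_box_def edge_step_def add_square_neq add_square_eq_iff the comm)
qed

lemma partition_antimono:
  assumes "is_partition p" "1 \<le> i" "i \<le> j"
  shows "p j \<le> p i"
  using assms(3)
proof (induction j rule: dec_induct)
  case (step n)
  then have "p (Suc n) \<le> p n" using assms(1,2) unfolding is_partition_def by auto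
  then show ?case using step by simp
qed simp

lemma is_partition_add_box_iff:
  assumes "is_partition p"
  shows "is_partition (add_box p k) \<longleftrightarrow> k \<le> 1 \<or> p k < p (k - 1)"
proof -
  have fin: "finite {i. (add_square p k) i \<noteq> 0}"
    by (rule finite_subset[of _ "insert k {i. p i \<noteq> 0}"])
      (use assms in \<open>auto simp: is_partition_def add_square_def\<close>)
  have dec: "\<And>i. 1 \<le> i \<Longrightarrow> p (Suc i) \<le> p i" and p0: "p 0 = 0"
    using assms by (auto simp: is_partition_def)
  consider "k = 0" | "k = 1" | m where "k = Suc m" "1 \<le> m" by (cases k) force+
  then show ?thesis
  proof cases
    case 1
    then show ?thesis using assms by (simp add: add_box_def)
  next
    case 2
    have "is_partition (add_square p 1)"
      unfolding is_partition_def using fin p0 dec 2 by (auto simp: add_square_def le_Suc_eq)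
    then show ?thesis using 2 by (simp add: add_box_def)
  next
    case 3
    have "is_partition (add_square p k) \<longleftrightarrow> p k < p m"
    proof
      assume "is_partition (add_square p k)"
      then have "add_square p k (Suc m) \<le> add_square p k m"
        using 3 by (simp add: is_partition_def)
      then show "p k < p m" using 3 by (simp add: add_square_def)
    next
      assume "p k < p m"
      then show "is_partition (add_square p k)"
        unfolding is_partition_def using fin p0 dec 3 by (auto simp: add_square_def le_Suc_eq)
    qed
    then show ?thesis using 3 by (simp add: add_box_def)
  qed
qed

text \<open>If \<open>q \<noteq> d\<close>, row \<open>q\<close> is unchanged and the row before it
  has not become shorter; if \<open>q = d\<close>, row \<open>d\<close> has just grown and leaves
  room in row \<open>Suc d\<close>.\<close>

lemma is_partition_local_rule:
  assumes p: "is_partition p" and d: "is_partition (add_box p d)" and q: "is_partition (add_box p q)"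
  shows "is_partition (local_rule one p (add_box p d) (add_box p q))"
proof -
  have "is_partition (add_box (add_box p d) (fst (edge_step one q d)))"
    unfolding is_partition_add_box_iff[OF d]
    using q[unfolded is_partition_add_box_iff[OF p]] d[unfolded is_partition_add_box_iff[OF p]]
      p[unfolded is_partition_def]
    by (auto simp: edge_step_def add_box_def add_square_def less_Suc_eq_le)
  then show ?thesis using local_rule_edge_step(1) by simp
qed

section \<open>Boxes of a diagram, counted by rows and by columns\<close>

definition boxes :: "ptn \<Rightarrow> (nat \<times> nat) set" where
  "boxes p = {(i, j). 1 \<le> i \<and> 1 \<le> j \<and> j \<le> p i}"

lemma boxes_add_box:
  assumes "k > 0"
  shows "boxes (add_box p k) = insert (k, Suc (p k)) (boxes p)" "(k, Suc (p k)) \<notin> boxes p"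
  using assms by (auto simp: boxes_def add_box_def add_square_def split: if_splits)

lemma card_boxes_rows:
  "card {z \<in> boxes p. fst z \<le> k} = (\<Sum>i=1..k. p i)"
proof -
  have "{z \<in> boxes p. fst z \<le> k} = Sigma {1..k} (\<lambda>i. {1..p i})"
    by (auto simp: boxes_def)
  then show ?thesis by simp
qed

lemma card_boxes_columns:
  assumes "finite (boxes p)"
  shows "card {z \<in> boxes p. snd z \<le> l} = (\<Sum>j=1..l. conjugate p j)"
proof -
  have "{z \<in> boxes p. snd z \<le> l} = prod.swap ` Sigma {1..l} (\<lambda>j. {i. 1 \<le> i \<and> j \<le> p i})"
    by (auto simp: boxes_def)
  then have "card {z \<in> boxes p. snd z \<le> l} = card (Sigma {1..l} (\<lambda>j. {i. 1 \<le> i \<and> j \<le> p i}))"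
    by (simp add: card_image)
  also have "\<dots> = (\<Sum>j=1..l. card {i. 1 \<le> i \<and> j \<le> p i})"
  proof (rule card_SigmaI)
    show "\<forall>j\<in>{1..l}. finite {i. 1 \<le> i \<and> j \<le> p i}"
    proof
      fix j assume j: "j \<in> {1..l}"
      have "{i. 1 \<le> i \<and> j \<le> p i} \<subseteq> fst ` boxes p"
        using j by (force simp: boxes_def)
      then show "finite {i. 1 \<le> i \<and> j \<le> p i}" using assms finite_surj by blast
    qed
  qed simp
  also have "\<dots> = (\<Sum>j=1..l. conjugate p j)"
    by (rule sum.cong) (auto simp: conjugate_def)
  finally show ?thesis .
qed

text \<open>The hypotheses say that \<open>(k, l)\<close> is a point on the boundary of the diagram of \<open>p\<close>.\<close>

lemma card_boxes_corner:
  assumes p: "is_partition p" and fin: "finite (boxes p)"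
    and inner: "k = 0 \<or> l \<le> p k" and outer: "p (Suc k) \<le> l"
  shows "(\<Sum>i=1..k. p i) + (\<Sum>j=1..l. conjugate p j) = card (boxes p) + k * l"
proof -
  let ?A = "{z \<in> boxes p. fst z \<le> k}" and ?B = "{z \<in> boxes p. snd z \<le> l}"
  have 1: "?A \<union> ?B = boxes p"
  proof -
    have "j \<le> l" if "1 \<le> i" "j \<le> p i" "\<not> i \<le> k" for i j
      using partition_antimono[OF p, of "Suc k" i] that outer by auto
    then show ?thesis by (fastforce simp: boxes_def)
  qed
  have 2: "?A \<inter> ?B = {1..k} \<times> {1..l}"
  proof -
    have "j \<le> p i" if "1 \<le> i" "j \<le> l" "i \<le> k" for i j
      using partition_antimono[OF p, of i k] that inner by auto
    then show ?thesis by (auto simp: boxes_def)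
  qed
  have "card ?A + card ?B = card (?A \<union> ?B) + card (?A \<inter> ?B)"
    using fin by (intro card_Un_Int) auto
  then show ?thesis
    using card_boxes_rows[of p k] card_boxes_columns[OF fin, of l] 1 2
    by (simp add: card_cartesian_product)
qed

section \<open>Weak duality of two kinds of colourings\<close>

lemma colourable_sym:
  "colourable Q k S \<Longrightarrow> colourable (\<lambda>a b. Q a b \<and> Q b a) k S"
  unfolding colourable_def by (elim ex_forward) auto

text \<open>An element of \<open>S \<inter> T\<close> is determined by its two colours, because two
  elements sharing both would be related by \<open>Q\<close> and by \<open>Q'\<close>. This bounds
  the intersection by \<open>k * l\<close>.\<close>

lemma card_colourable_add:
  assumes "finite H" "S \<subseteq> H" "T \<subseteq> H" and S: "colourable Q k S" and T: "colourable Q' l T"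
    and excl: "\<And>a b. a \<in> H \<Longrightarrow> b \<in> H \<Longrightarrow> a \<noteq> b \<Longrightarrow> Q a b \<Longrightarrow> \<not> Q' a b"
  shows "card S + card T \<le> card H + k * l"
proof -
  obtain c where c: "\<forall>a\<in>S. c a < k" "\<forall>a\<in>S. \<forall>b\<in>S. a \<noteq> b \<and> c a = c b \<longrightarrow> Q a b"
    using S unfolding colourable_def by blast
  obtain d where d: "\<forall>a\<in>T. d a < l" "\<forall>a\<in>T. \<forall>b\<in>T. a \<noteq> b \<and> d a = d b \<longrightarrow> Q' a b"
    using T unfolding colourable_def by blast
  have "inj_on (\<lambda>a. (c a, d a)) (S \<inter> T)"
    using c d excl assms(2) by (intro inj_onI) (simp, metis subsetD)
  moreover have "(\<lambda>a. (c a, d a)) ` (S \<inter> T) \<subseteq> {..<k} \<times> {..<l}" using c d by auto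
  ultimately have "card (S \<inter> T) \<le> card ({..<k} \<times> {..<l})"
    by (rule card_inj_on_le) simp
  moreover have "card (S \<union> T) \<le> card H" using assms by (intro card_mono) auto
  moreover have "card S + card T = card (S \<union> T) + card (S \<inter> T)"
    using assms by (intro card_Un_Int) (auto intro: finite_subset)
  ultimately show ?thesis by (simp add: card_cartesian_product)
qed

definition ne_comparable :: "nat \<times> nat \<Rightarrow> nat \<times> nat \<Rightarrow> bool" where
  "ne_comparable u v \<longleftrightarrow> fst u < fst v \<and> snd u < snd v \<or> fst v < fst u \<and> snd v < snd u"

section \<open>Greene's theorem for growth diagrams\<close>

text \<open>Everything is required only in the rectangle below the corner \<open>(X, Y)\<close>;
  there every cell belongs to \<open>G\<close>, so the dummy branch of \<open>growth_label\<close>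
  is never reached.\<close>

locale rook_growth =
  fixes G P :: "cell set" and X Y :: nat
  assumes rect: "\<And>c a. 1 \<le> c \<Longrightarrow> c \<le> X \<Longrightarrow> 1 \<le> a \<Longrightarrow> a \<le> Y \<Longrightarrow> (c, a) \<in> G"
    and row_unique: "\<And>c c' a. (c, a) \<in> P \<Longrightarrow> (c', a) \<in> P \<Longrightarrow> 1 \<le> c \<Longrightarrow> 1 \<le> c' \<Longrightarrow> c \<le> X \<Longrightarrow> c' \<le> X
          \<Longrightarrow> 1 \<le> a \<Longrightarrow> a \<le> Y \<Longrightarrow> c = c'"
    and col_unique: "\<And>c a a'. (c, a) \<in> P \<Longrightarrow> (c, a') \<in> P \<Longrightarrow> 1 \<le> a \<Longrightarrow> 1 \<le> a' \<Longrightarrow> a \<le> Y \<Longrightarrow> a' \<le> Y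
          \<Longrightarrow> 1 \<le> c \<Longrightarrow> c \<le> X \<Longrightarrow> a = a'"
begin

abbreviation "L \<equiv> growth_label G P"
abbreviation "r x a \<equiv> fst (edges P x a)"
abbreviation "d x a \<equiv> snd (edges P x a)"

lemma d_0 [simp]: "d x 0 = 0" by (cases x) auto

lemma L_0 [simp]: "L x 0 = empty_ptn" by (cases x) auto

text \<open>The two claims are intertwined: the vertical edges on line \<open>x\<close> give the
  horizontal ones to its right by induction on the height, and both together give the vertical edges
  on the next line.\<close>

lemma labels_along_edges:
  assumes "x \<le> X"
  shows "a < Y \<Longrightarrow> L x (Suc a) = add_box (L x a) (r x (Suc a))"
    and "x < X \<Longrightarrow> a \<le> Y \<Longrightarrow> L (Suc x) a = add_box (L x a) (d (Suc x) a)"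
proof -
  have "(\<forall>a<Y. L x (Suc a) = add_box (L x a) (r x (Suc a))) \<and>
      (x < X \<longrightarrow> (\<forall>a\<le>Y. L (Suc x) a = add_box (L x a) (d (Suc x) a)))"
    using assms
  proof (induction x)
    case 0
    have "L (Suc 0) a = add_box (L 0 a) (d (Suc 0) a)" if "a \<le> Y" "0 < X" for a
      using that
    proof (induction a)
      case (Suc a)
      have "(Suc 0, Suc a) \<in> G" using rect Suc by simp
      then show ?case
        using local_rule_edge_step(2)[of _ "L 0 a" "d (Suc 0) a" 0] Suc by (simp add: add_box_def)
    qed (simp add: add_box_def)
    then show ?case by (simp add: add_box_def)
  next
    case (Suc x)
    have IH: "L x (Suc a) = add_box (L x a) (r x (Suc a))" if "a < Y" for a
      using Suc that by simp
    have IH': "L (Suc x) a = add_box (L x a) (d (Suc x) a)" if "a \<le> Y" for a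
      using Suc that by simp
    have E: "L (Suc x) (Suc a) = add_box (L (Suc x) a) (r (Suc x) (Suc a))" if "a < Y" for a
    proof -
      have "(Suc x, Suc a) \<in> G" using rect Suc.prems that by simp
      then show ?thesis
        using local_rule_edge_step(1) IH[OF that] IH'[of a] that by simp
    qed
    have "L (Suc (Suc x)) a = add_box (L (Suc x) a) (d (Suc (Suc x)) a)"
      if "a \<le> Y" "Suc x < X" for a
      using that
    proof (induction a)
      case (Suc a)
      have "(Suc (Suc x), Suc a) \<in> G" using rect Suc by simp
      then show ?case
        using local_rule_edge_step(2) Suc E[of a] by simp
    qed (simp add: add_box_def)
    then show ?case using E by blast
  qed
  then show "a < Y \<Longrightarrow> L x (Suc a) = add_box (L x a) (r x (Suc a))"
    and "x < X \<Longrightarrow> a \<le> Y \<Longrightarrow> L (Suc x) a = add_box (L x a) (d (Suc x) a)"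
    by blast+
qed

lemma is_partition_label: "x \<le> X \<Longrightarrow> a \<le> Y \<Longrightarrow> is_partition (L x a)"
proof (induction x arbitrary: a)
  case 0
  then show ?case by (simp add: is_partition_def empty_ptn_def)
next
  case (Suc x)
  note IHx = Suc.IH and xX = Suc.prems(1)
  from Suc.prems(2) show ?case
  proof (induction a)
    case 0
    then show ?case by (simp add: is_partition_def empty_ptn_def)
  next
    case (Suc a)
    have "(Suc x, Suc a) \<in> G" using rect xX Suc by simp
    moreover have "is_partition (L x a)" "is_partition (L x (Suc a))" "is_partition (L (Suc x) a)"
      using IHx xX Suc by simp_all
    ultimately show ?case
      using is_partition_local_rule labels_along_edges[of x a] xX Suc.prems by simp
  qed
qed

lemma edge_step_pos:
  "fst (edge_step one q e) > 0 \<longleftrightarrow> q > 0 \<or> one \<and> e = 0"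
  "snd (edge_step one q e) > 0 \<longleftrightarrow> e > 0 \<or> one \<and> q = 0"
  by (auto simp: edge_step_def)

text \<open>Once nonzero, a label stays nonzero along its row or column of cells, and it can only be
  born at a point. Uniqueness in rows and columns ensures that a point meets two zero labels, so
  (F6) does apply.\<close>

lemma edges_pos:
  assumes "x \<le> X"
  shows "1 \<le> a \<Longrightarrow> a \<le> Y \<Longrightarrow> r x a > 0 \<longleftrightarrow> (\<exists>c. 1 \<le> c \<and> c \<le> x \<and> (c, a) \<in> P)"
    and "x < X \<Longrightarrow> a \<le> Y \<Longrightarrow> d (Suc x) a > 0 \<longleftrightarrow> (\<exists>b. 1 \<le> b \<and> b \<le> a \<and> (Suc x, b) \<in> P)"
proof -
  let ?r = "\<lambda>x. \<forall>a. 1 \<le> a \<longrightarrow> a \<le> Y \<longrightarrow> (r x a > 0 \<longleftrightarrow> (\<exists>c. 1 \<le> c \<and> c \<le> x \<and> (c, a) \<in> P))"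
  let ?d = "\<lambda>x a. d (Suc x) a > 0 \<longleftrightarrow> (\<exists>b. 1 \<le> b \<and> b \<le> a \<and> (Suc x, b) \<in> P)"
  have D: "?d x a" if R: "?r x" and "x < X" "a \<le> Y" for x a
    using \<open>a \<le> Y\<close>
  proof (induction a)
    case (Suc a)
    have "r x (Suc a) = 0" if "(Suc x, Suc a) \<in> P"
    proof (rule ccontr)
      assume "r x (Suc a) \<noteq> 0"
      then obtain c where c: "1 \<le> c" "c \<le> x" "(c, Suc a) \<in> P" using R Suc.prems by auto
      then show False using row_unique[of c "Suc a" "Suc x"] that \<open>x < X\<close> Suc.prems by auto
    qed
    then have "d (Suc x) (Suc a) > 0 \<longleftrightarrow> d (Suc x) a > 0 \<or> (Suc x, Suc a) \<in> P"
      using edge_step_pos(2) by auto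
    then show ?case using Suc by (auto simp: le_Suc_eq)
  qed simp
  have R: "?r x" if "x \<le> X" for x
    using that
  proof (induction x)
    case (Suc x)
    show ?case
    proof (intro allI impI)
      fix a assume a: "1 \<le> a" "a \<le> Y"
      then obtain a' where a': "a = Suc a'" by (cases a) auto
      have "d (Suc x) a' = 0" if "(Suc x, a) \<in> P"
      proof (rule ccontr)
        assume "d (Suc x) a' \<noteq> 0"
        then obtain b where "1 \<le> b" "b \<le> a'" "(Suc x, b) \<in> P" using D[of x a'] Suc a a' by auto
        then show False using col_unique[of "Suc x" b a] that Suc.prems a a' by auto
      qed
      then have "r (Suc x) a > 0 \<longleftrightarrow> r x a > 0 \<or> (Suc x, a) \<in> P"
        using edge_step_pos(1) a' by auto
      then show "r (Suc x) a > 0 \<longleftrightarrow> (\<exists>c. 1 \<le> c \<and> c \<le> Suc x \<and> (c, a) \<in> P)"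
        using Suc a by (auto simp: le_Suc_eq)
    qed
  qed simp
  show "1 \<le> a \<Longrightarrow> a \<le> Y \<Longrightarrow> r x a > 0 \<longleftrightarrow> (\<exists>c. 1 \<le> c \<and> c \<le> x \<and> (c, a) \<in> P)"
    "x < X \<Longrightarrow> a \<le> Y \<Longrightarrow> d (Suc x) a > 0 \<longleftrightarrow> (\<exists>b. 1 \<le> b \<and> b \<le> a \<and> (Suc x, b) \<in> P)"
    using R D assms by auto
qed

section \<open>Heights as letters of a permutation\<close>

definition H :: "nat set" where "H = {a. 1 \<le> a \<and> a \<le> Y \<and> r X a > 0}"

definition column :: "nat \<Rightarrow> nat" where
  "column a = (THE c. 1 \<le> c \<and> c \<le> X \<and> (c, a) \<in> P)"

lemma finite_H: "finite H" unfolding H_def by simp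

lemma column:
  assumes "a \<in> H"
  shows "1 \<le> column a" "column a \<le> X" "(column a, a) \<in> P"
proof -
  obtain c where c: "1 \<le> c" "c \<le> X" "(c, a) \<in> P"
    using assms edges_pos(1)[of X a] unfolding H_def by auto
  have "1 \<le> column a \<and> column a \<le> X \<and> (column a, a) \<in> P"
    unfolding column_def
  proof (rule theI[of _ c])
    fix c' assume "1 \<le> c' \<and> c' \<le> X \<and> (c', a) \<in> P"
    then show "c' = c" using c row_unique[of c' a c] assms by (simp add: H_def)
  qed (use c in blast)
  then show "1 \<le> column a" "column a \<le> X" "(column a, a) \<in> P" by blast+
qed

lemma H_I:
  assumes "(c, a) \<in> P" "1 \<le> c" "c \<le> X" "1 \<le> a" "a \<le> Y"
  shows "a \<in> H" "column a = c"
proof -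
  show "a \<in> H" using assms edges_pos(1)[of X a] unfolding H_def by auto
  then show "column a = c" using column[of a] row_unique[of "column a" a c] assms by auto
qed

lemma column_inj: "a \<in> H \<Longrightarrow> b \<in> H \<Longrightarrow> column a = column b \<Longrightarrow> a = b"
  using column[of a] column[of b] col_unique[of "column a" a b] by (auto simp: H_def)

lemma r_pos_iff_column:
  assumes "a \<in> H" "x \<le> X"
  shows "r x a > 0 \<longleftrightarrow> column a \<le> x"
proof -
  have a: "1 \<le> a" "a \<le> Y" using assms by (auto simp: H_def)
  have "column a = c" if "1 \<le> c" "c \<le> x" "(c, a) \<in> P" for c
    using H_I(2)[of c a] that a assms(2) by simp
  then show ?thesis using edges_pos(1)[OF assms(2) a] column[OF assms(1)] by auto
qed

text \<open>In state \<open>x\<close> the points in columns \<open>\<le> x\<close> are replaced by the tableau recorded by the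
  labels on the line \<open>x\<close>, read row by row with the first row last; the points further right are
  still in place. Larger positions are further to the left, and odd positions are kept free
  for the element that is being bumped.\<close>

definition pos :: "nat \<Rightarrow> nat \<Rightarrow> int" where
  "pos x a = (if r x a > 0 then 2 * int (r x a) else - int (column a))"

text \<open>A column of cells containing a point performs one row insertion. Its domination is
  composed of a renumbering when the new letter starts, one use of the locale \<open>bump\<close>
  for each bumped height, and a renumbering when the last letter settles.\<close>

lemma pos_step:
  assumes xX: "x < X"
  shows "dominated H (pos (Suc x)) (pos x)"
proof (cases "\<exists>h. 1 \<le> h \<and> h \<le> Y \<and> (Suc x, h) \<in> P")
  case False
  have "pos (Suc x) a = pos x a" if aH: "a \<in> H" for a
  proof -
    obtain a' where a': "a = Suc a'" using aH unfolding H_def by (cases a) auto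
    have "d (Suc x) a' = 0" "(Suc x, a) \<notin> P"
      using edges_pos(2)[of x a'] xX False aH a' unfolding H_def by auto
    then show ?thesis using a' by (simp add: pos_def edge_step_def)
  qed
  then show ?thesis by (intro dominated_same_order) auto
next
  case True
  then obtain h where h: "1 \<le> h" "h \<le> Y" "(Suc x, h) \<in> P" by blast
  then have hH: "h \<in> H" and colh: "column h = Suc x" using H_I[of "Suc x" h] xX by auto
  define D where "D = d (Suc x)"
  \<comment> \<open>The word when the scan has reached height \<open>i\<close>: heights up to
    \<open>i\<close> have their new places, higher ones still the old, and \<open>b\<close> waits at
    the odd position \<open>2 * D i - 1\<close>, one step to the right of row
    \<open>D i\<close>.\<close>
  define M where "M i b a = (if a = b then 2 * int (D i) - 1
      else if a \<le> i then pos (Suc x) a else pos x a)" for i b a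
  have even_or_neg: "pos y a = 2 * int (r y a) \<and> r y a > 0 \<or> pos y a < 0 \<and> r y a = 0" if "a \<in> H" for y a
    using column(1)[OF that] by (auto simp: pos_def)
  have odd: "pos y a \<noteq> 2 * int n + 1" "n > 0 \<Longrightarrow> pos y a = 2 * int n \<longleftrightarrow> r y a = n"
    if "a \<in> H" for y a n
    using even_or_neg[OF that, of y] by (auto, presburger)
  have before: "D a = 0 \<and> pos (Suc x) a = pos x a" if "a < h" for a
  proof -
    have z: "D b = 0" if bh: "b < h" for b
    proof (rule ccontr)
      assume "D b \<noteq> 0"
      then obtain e where "1 \<le> e" "e \<le> b" "(Suc x, e) \<in> P"
        using edges_pos(2)[of x b] xX bh h unfolding D_def by auto
      then show False using col_unique[of "Suc x" e h] h bh xX by auto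
    qed
    show ?thesis
    proof (cases a)
      case 0
      then show ?thesis using z that by (cases x) (auto simp: pos_def)
    next
      case (Suc a')
      have "(Suc x, a) \<notin> P" using col_unique[of "Suc x" a h] h that xX Suc by auto
      then show ?thesis using z[of a'] z[OF that] that Suc
        by (auto simp: pos_def edge_step_def D_def split: if_splits)
    qed
  qed
  \<comment> \<open>Scanning the heights upwards, \<open>b\<close> is the height bumped last; it waits to the right of row \<open>D i\<close>.\<close>
  have inv: "\<exists>b\<in>H. b \<le> i \<and> D i \<ge> 1 \<and> r (Suc x) b = D i \<and> (\<forall>a. b < a \<and> a \<le> i \<longrightarrow> r (Suc x) a \<noteq> D i)
      \<and> dominated H (M i b) (pos x)" if "h \<le> i" "i \<le> Y" for i
    using that
  proof (induction i rule: dec_induct)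
    case base
    obtain h' where h': "h = Suc h'" using h by (cases h) auto
    have "r x h = 0" using r_pos_iff_column[OF hH, of x] colh xX by auto
    moreover have "D h' = 0" using before h' by auto
    ultimately have e: "r (Suc x) h = 1" "D h = 1" using h h' unfolding D_def by (auto simp: edge_step_def)
    have M: "M h h a = pos x a" if "a \<noteq> h" for a
      using before[of a] that unfolding M_def by auto
    have px: "pos x h = - int (Suc x)" using \<open>r x h = 0\<close> colh by (simp add: pos_def)
    have other: "pos x a \<ge> 2 \<or> pos x a < - int (Suc x)" if "a \<in> H" "a \<noteq> h" for a
    proof (cases "r x a > 0")
      case False
      then have "column a \<noteq> Suc x" "\<not> column a \<le> x"
        using column_inj[OF that(1) hH] colh that r_pos_iff_column[OF that(1), of x] xX by auto
      then show ?thesis using False by (auto simp: pos_def)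
    qed (auto simp: pos_def)
    \<comment> \<open>The new letter leads the unread part at \<open>- Suc x\<close> and moves to
      \<open>1\<close>, just right of row 1; no other letter lies between these places.\<close>
    have "dominated H (M h h) (pos x)"
    proof (rule dominated_same_order)
      fix a b assume "a \<in> H" "b \<in> H" "a < b"
      then show "(M h h a < M h h b) = (pos x a < pos x b)"
        using M[of a] M[of b] other[of a] other[of b] px e unfolding M_def by fastforce
    qed
    then show ?case using hH e by auto
  next
    case (step i)
    then obtain b where b: "b \<in> H" "b \<le> i" "D i \<ge> 1" "r (Suc x) b = D i"
      "\<And>a. b < a \<Longrightarrow> a \<le> i \<Longrightarrow> r (Suc x) a \<noteq> D i" "dominated H (M i b) (pos x)" by auto
    have st: "edges P (Suc x) (Suc i) = edge_step ((Suc x, Suc i) \<in> P) (r x (Suc i)) (D i)"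
      unfolding D_def by simp
    show ?case
    proof (cases "r x (Suc i) = D i")
      case False
      then have e: "r (Suc x) (Suc i) = r x (Suc i)" "D (Suc i) = D i"
        using st b(3) unfolding D_def by (auto simp: edge_step_def)
      have "M (Suc i) b = M i b"
        using e by (auto simp: M_def fun_eq_iff le_Suc_eq pos_def)
      then show ?thesis using b e False by (auto simp: le_Suc_eq intro!: bexI[of _ b])
    next
      case True
      then have e: "r (Suc x) (Suc i) = Suc (D i)" "D (Suc i) = Suc (D i)"
        using st b(3) unfolding D_def by (auto simp: edge_step_def)
      have zH: "Suc i \<in> H"
      proof -
        obtain c where "1 \<le> c" "c \<le> x" "(c, Suc i) \<in> P"
          using edges_pos(1)[of x "Suc i"] True b(3) xX step by auto
        then show ?thesis using H_I[of c "Suc i"] xX step by auto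
      qed
      \<comment> \<open>The bumped height lands at \<open>2 * D i + 1\<close>, which equals
        \<open>2 * (D i + 1) - 1\<close>, the waiting place of the next row. It is the first letter
        of its row above \<open>b\<close>, because the invariant excludes the heights from
        \<open>b\<close> up to \<open>i\<close>.\<close>
      interpret bump H "M i b" "M (Suc i) (Suc i)" "2 * int (D i)" b "Suc i"
      proof
        show "M i b (Suc i) = 2 * int (D i)"
          using b True by (simp add: M_def pos_def)
        show "M (Suc i) (Suc i) b = 2 * int (D i)"
          using b by (simp add: M_def pos_def)
        show "M (Suc i) (Suc i) a = M i b a" if "a \<in> H" "a \<noteq> b" "a \<noteq> Suc i" for a
          using that by (auto simp: M_def)
        show "M i b a \<noteq> 2 * int (D i) - 1 \<and> M i b a \<noteq> 2 * int (D i) + 1"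
          if "a \<in> H" "a \<noteq> b" "a \<noteq> Suc i" for a
          using odd(1)[OF that(1), of _ "D i"] odd(1)[OF that(1), of _ "D i - 1"] b(3) that
          by (auto simp: M_def of_nat_diff)
        show "M i b a \<noteq> 2 * int (D i)" if "a \<in> H" "b < a" "a < Suc i" for a
          using that b(3) b(5)[of a] odd(2)[OF that(1), of "D i" "Suc x"] by (auto simp: M_def)
      qed (use finite_H zH b e in \<open>auto simp: M_def\<close>)
      have "dominated H (M (Suc i) (Suc i)) (pos x)"
        using dominated_trans[OF dominated b(6)] .
      then show ?thesis using zH e by auto
    qed
  qed
  obtain b where b: "b \<in> H" "b \<le> Y" "D Y \<ge> 1" "r (Suc x) b = D Y"
    "\<And>a. b < a \<Longrightarrow> a \<le> Y \<Longrightarrow> r (Suc x) a \<noteq> D Y" "dominated H (M Y b) (pos x)"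
    using inv[of Y] h by auto
  \<comment> \<open>When \<open>b\<close> steps from \<open>2 * D Y - 1\<close> into row
    \<open>D Y\<close>, the only comparisons at risk involve a larger letter of that row, excluded
    by the invariant, or a smaller letter at the odd position being left, where no other letter
    stands.\<close>
  have "dominated H (pos (Suc x)) (M Y b)"
  proof (rule dominated_same_order)
    fix u v assume uv: "u \<in> H" "v \<in> H" "u < v"
    have Y: "u \<le> Y" "v \<le> Y" using uv by (auto simp: H_def)
    have pb: "pos (Suc x) b = 2 * int (D Y)" using b by (simp add: pos_def)
    consider "u = b" | "v = b" | "u \<noteq> b" "v \<noteq> b" by blast
    then show "(pos (Suc x) u < pos (Suc x) v) = (M Y b u < M Y b v)"
    proof cases
      case 1
      then have "pos (Suc x) v \<noteq> 2 * int (D Y)" using odd(2)[OF uv(2)] b(3) b(5)[of v] uv Y by auto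
      then show ?thesis using 1 uv Y pb by (auto simp: M_def)
    next
      case 2
      have "pos (Suc x) u \<noteq> 2 * int (D Y) - 1"
        using odd(1)[OF uv(1), of "Suc x" "D Y - 1"] b(3) by (auto simp: of_nat_diff)
      then show ?thesis using 2 uv Y pb by (auto simp: M_def)
    next
      case 3 then show ?thesis using Y by (auto simp: M_def)
    qed
  qed
  then show ?thesis using dominated_trans b(6) by blast
qed

lemma pos_dominated: "x \<le> X \<Longrightarrow> dominated H (pos x) (pos 0)"
proof (induction x)
  case (Suc x)
  then show ?case using dominated_trans[OF pos_step[of x]] by simp
qed (rule dominated_refl)

text \<open>The place of \<open>a\<close> in the standard tableau: the square that the label gains
  on passing height \<open>a\<close> upwards, whose column is the new length of its row.\<close>

definition box :: "nat \<Rightarrow> nat \<times> nat" where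
  "box a = (r X a, L X a (r X a))"

lemma label_step:
  assumes "Suc a \<in> H"
  shows "L X (Suc a) = add_box (L X a) (r X (Suc a))" "box (Suc a) = (r X (Suc a), Suc (L X a (r X (Suc a))))"
proof -
  show "L X (Suc a) = add_box (L X a) (r X (Suc a))"
    using assms labels_along_edges(1)[of X a] by (simp add: H_def)
  then show "box (Suc a) = (r X (Suc a), Suc (L X a (r X (Suc a))))"
    using assms unfolding box_def H_def by (simp add: add_box_def add_square_def)
qed

lemma boxes_label:
  assumes "n \<le> Y"
  shows "boxes (L X n) = box ` {a \<in> H. a \<le> n} \<and> inj_on box {a \<in> H. a \<le> n}"
  using assms
proof (induction n)
  case 0
  have e: "{a \<in> H. a \<le> 0} = {}" by (auto simp: H_def)
  show ?case unfolding e by (auto simp: boxes_def empty_ptn_def)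
next
  case (Suc n)
  then have IH: "boxes (L X n) = box ` {a \<in> H. a \<le> n}" "inj_on box {a \<in> H. a \<le> n}" by simp_all
  show ?case
  proof (cases "Suc n \<in> H")
    case False
    then have "r X (Suc n) = 0" using Suc.prems by (simp add: H_def)
    then have "L X (Suc n) = L X n"
      using labels_along_edges(1)[of X n] Suc.prems by (simp add: add_box_def)
    moreover have "{a \<in> H. a \<le> Suc n} = {a \<in> H. a \<le> n}" using False by (auto simp: le_Suc_eq)
    ultimately show ?thesis using IH by simp
  next
    case True
    have eq: "{a \<in> H. a \<le> Suc n} = insert (Suc n) {a \<in> H. a \<le> n}" using True by (auto simp: le_Suc_eq)
    have "r X (Suc n) > 0" using True by (simp add: H_def)
    from boxes_add_box[OF this, of "L X n"] show ?thesis
      unfolding eq using IH label_step[OF True] by (auto simp: inj_on_insert)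
  qed
qed

lemma label_mono:
  assumes "a \<le> b" "b \<le> Y"
  shows "L X a i \<le> L X b i"
  using assms
proof (induction b rule: dec_induct)
  case (step n)
  then show ?case using labels_along_edges(1)[of X n]
    by (auto simp: add_box_def add_square_def le_Suc_eq)
qed simp

lemma H_bounds: "{a \<in> H. a \<le> Y} = H" by (auto simp: H_def)

lemma box_bij: "bij_betw box H (boxes (L X Y))"
  using boxes_label[of Y] unfolding H_bounds bij_betw_def by simp

lemma card_box_filter: "card {a \<in> H. R (box a)} = card {z \<in> boxes (L X Y). R z}"
proof -
  have "{z \<in> box ` H. R z} = box ` {a \<in> H. R (box a)}" by auto
  then have "{z \<in> boxes (L X Y). R z} = box ` {a \<in> H. R (box a)}"
    using box_bij unfolding bij_betw_def by simp
  moreover have "inj_on box {a \<in> H. R (box a)}"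
    using box_bij unfolding bij_betw_def by (auto intro: inj_on_subset)
  ultimately show ?thesis by (simp add: card_image)
qed

lemma finite_boxes: "finite (boxes (L X Y))"
  using bij_betw_finite[OF box_bij] finite_H by simp

lemma box_pos: "a \<in> H \<Longrightarrow> fst (box a) \<ge> 1 \<and> snd (box a) \<ge> 1"
  using bij_betwE[OF box_bij] by (cases "box a") (auto simp: boxes_def dest!: bspec)

lemma rows_colourable: "colourable (up (pos X)) k {a \<in> H. fst (box a) \<le> k}"
  unfolding colourable_def
proof (intro exI[of _ "\<lambda>a. fst (box a) - 1"] conjI ballI impI)
  fix a assume "a \<in> {a \<in> H. fst (box a) \<le> k}"
  then show "fst (box a) - 1 < k" using box_pos[of a] by auto
next
  fix a b assume "a \<in> {a \<in> H. fst (box a) \<le> k}" "b \<in> {a \<in> H. fst (box a) \<le> k}"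
    and ab: "a \<noteq> b \<and> fst (box a) - 1 = fst (box b) - 1"
  then have "fst (box a) = fst (box b)" "fst (box a) \<ge> 1" using box_pos[of a] box_pos[of b] by auto
  then show "up (pos X) a b" by (simp add: up_def pos_def box_def)
qed

text \<open>Suppose \<open>b\<close> stood in the same or an earlier row. The row of
  \<open>a\<close> already reached the common column when \<open>a\<close> arrived, hence so did the
  row of \<open>b\<close>, which is at least as long; but \<open>b\<close> opens that column in its
  row.\<close>

lemma column_rows_increasing:
  assumes a: "a \<in> H" and b: "b \<in> H" and ab: "a < b" and eq: "snd (box a) = snd (box b)"
  shows "r X a < r X b"
proof (rule ccontr)
  assume "\<not> r X a < r X b"
  obtain b' where b': "b = Suc b'" using ab by (cases b) auto
  have Y: "b \<le> Y" using b by (simp add: H_def)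
  have "L X a (r X a) \<le> L X b' (r X a)" using label_mono[of a b'] ab b' Y by simp
  also have "\<dots> \<le> L X b' (r X b)"
    using partition_antimono[OF is_partition_label[of X b'], of "r X b" "r X a"] \<open>\<not> r X a < r X b\<close> b Y b'
    by (simp add: H_def)
  finally show False using eq label_step(2)[of b'] b b' by (simp add: box_def)
qed

lemma columns_colourable: "colourable (down (pos X)) l {a \<in> H. snd (box a) \<le> l}"
  unfolding colourable_def
proof (intro exI[of _ "\<lambda>a. snd (box a) - 1"] conjI ballI impI)
  fix a assume "a \<in> {a \<in> H. snd (box a) \<le> l}"
  then show "snd (box a) - 1 < l" using box_pos[of a] by auto
next
  fix a b assume "a \<in> {a \<in> H. snd (box a) \<le> l}" "b \<in> {a \<in> H. snd (box a) \<le> l}"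
    and ab: "a \<noteq> b \<and> snd (box a) - 1 = snd (box b) - 1"
  then have H: "a \<in> H" "b \<in> H" by auto
  then have "snd (box a) = snd (box b)" using ab box_pos[of a] box_pos[of b] by auto
  then show "down (pos X) a b"
    using column_rows_increasing[OF H] H unfolding down_def pos_def H_def by auto
qed

section \<open>Greene families among the points of the rectangle\<close>

definition points :: "(nat \<times> nat) set" where
  "points = {(c, a). (c, a) \<in> P \<and> 1 \<le> c \<and> c \<le> X \<and> 1 \<le> a \<and> a \<le> Y}"

lemma points_eq: "points = (\<lambda>a. (column a, a)) ` H"
proof
  show "points \<subseteq> (\<lambda>a. (column a, a)) ` H" using H_I by (force simp: points_def)
  show "(\<lambda>a. (column a, a)) ` H \<subseteq> points" using column by (auto simp: points_def H_def)
qed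

lemma finite_points: "finite points"
  unfolding points_eq using finite_H by simp

lemma card_points: "card points = card (boxes (L X Y))"
  using card_image[of "\<lambda>a. (column a, a)" H] bij_betw_same_card[OF box_bij]
  unfolding points_eq by (simp add: inj_on_def)

lemma initial_positions:
  assumes "a \<in> H" "b \<in> H" "a \<noteq> b"
  shows "up (pos 0) a b \<and> up (pos 0) b a \<Longrightarrow> ne_comparable (column a, a) (column b, b)"
    and "down (pos 0) a b \<and> down (pos 0) b a \<Longrightarrow> \<not> ne_comparable (column a, a) (column b, b)"
proof -
  have c: "column a < column b \<or> column b < column a" using column_inj[OF assms(1,2)] assms(3) by linarith
  have ab: "a < b \<or> b < a" using assms(3) by linarith
  have p: "pos 0 e = - int (column e)" for e by (simp add: pos_def)
  show "up (pos 0) a b \<and> up (pos 0) b a \<Longrightarrow> ne_comparable (column a, a) (column b, b)"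
    using ab c unfolding up_def p ne_comparable_def fst_conv snd_conv by linarith
  show "down (pos 0) a b \<and> down (pos 0) b a \<Longrightarrow> \<not> ne_comparable (column a, a) (column b, b)"
    using ab c unfolding down_def p ne_comparable_def fst_conv snd_conv by linarith
qed

lemma exists_ne_colouring:
  "\<exists>S\<subseteq>points. card S = (\<Sum>i=1..k. L X Y i) \<and> colourable ne_comparable k S"
proof -
  obtain T where T: "T \<subseteq> H" "card T = card {a \<in> H. fst (box a) \<le> k}" "colourable (up (pos 0)) k T"
    using dominated_up[OF pos_dominated _ rows_colourable] by blast
  have "colourable ne_comparable k ((\<lambda>a. (column a, a)) ` T)"
    by (rule colourable_image[OF colourable_sym[OF T(3)]])
      (use initial_positions(1) T(1) in \<open>auto simp: inj_on_def\<close>)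
  moreover have "card ((\<lambda>a. (column a, a)) ` T) = card T" by (rule card_image) (simp add: inj_on_def)
  ultimately show ?thesis
    using T card_box_filter[of "\<lambda>z. fst z \<le> k"] card_boxes_rows[of "L X Y" k] unfolding points_eq
    by (intro exI[of _ "(\<lambda>a. (column a, a)) ` T"]) auto
qed

lemma exists_SE_colouring:
  "\<exists>S\<subseteq>points. card S = (\<Sum>j=1..l. conjugate (L X Y) j)
     \<and> colourable (\<lambda>u v. \<not> ne_comparable u v) l S"
proof -
  obtain T where T: "T \<subseteq> H" "card T = card {a \<in> H. snd (box a) \<le> l}" "colourable (down (pos 0)) l T"
    using dominated_down[OF pos_dominated _ columns_colourable] by blast
  have "colourable (\<lambda>u v. \<not> ne_comparable u v) l ((\<lambda>a. (column a, a)) ` T)"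
    by (rule colourable_image[OF colourable_sym[OF T(3)]])
      (use initial_positions(2) T(1) in \<open>auto simp: inj_on_def\<close>)
  moreover have "card ((\<lambda>a. (column a, a)) ` T) = card T" by (rule card_image) (simp add: inj_on_def)
  ultimately show ?thesis
    using T card_box_filter[of "\<lambda>z. snd z \<le> l"] card_boxes_columns[OF finite_boxes, of l] unfolding points_eq
    by (intro exI[of _ "(\<lambda>a. (column a, a)) ` T"]) auto
qed

lemma is_partition_final: "is_partition (L X Y)" by (simp add: is_partition_label)

lemma weak_duality:
  assumes "S \<subseteq> points" "T \<subseteq> points" "colourable ne_comparable k S"
    "colourable (\<lambda>u v. \<not> ne_comparable u v) l T"
  shows "card S + card T \<le> card (boxes (L X Y)) + k * l"
  using card_colourable_add[OF finite_points assms] card_points by simp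

lemma ne_colouring_bound:
  assumes "S \<subseteq> points" "colourable ne_comparable k S"
  shows "card S \<le> (\<Sum>i=1..k. L X Y i)"
proof -
  \<comment> \<open>The length of row \<open>k\<close> puts \<open>(k, l)\<close> on the boundary of
    the diagram, where the duality bound is attained. For \<open>k = 0\<close> the first row is
    taken, since index 0 only carries the conventional value 0.\<close>
  define l where "l = (if k = 0 then L X Y 1 else L X Y k)"
  obtain T where "T \<subseteq> points" "card T = (\<Sum>j=1..l. conjugate (L X Y) j)"
    "colourable (\<lambda>u v. \<not> ne_comparable u v) l T"
    using exists_SE_colouring by blast
  then have "card S + (\<Sum>j=1..l. conjugate (L X Y) j) \<le> card (boxes (L X Y)) + k * l"
    using weak_duality assms by metis
  moreover have "L X Y (Suc k) \<le> l"
    using partition_antimono[OF is_partition_final, of k "Suc k"] by (simp add: l_def)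
  moreover have "k = 0 \<or> l \<le> L X Y k" by (simp add: l_def)
  ultimately show ?thesis
    using card_boxes_corner[OF is_partition_final finite_boxes, of k l] by linarith
qed

lemma SE_colouring_bound:
  assumes "S \<subseteq> points" "colourable (\<lambda>u v. \<not> ne_comparable u v) l S"
  shows "card S \<le> (\<Sum>j=1..l. conjugate (L X Y) j)"
proof -
  let ?p = "L X Y"
  have ex: "\<exists>n. ?p (Suc n) \<le> l"
  proof -
    have "finite {i. ?p i \<noteq> 0}" using is_partition_final by (simp add: is_partition_def)
    then obtain n where "\<forall>i\<in>{i. ?p i \<noteq> 0}. i < n" using finite_nat_set_iff_bounded by blast
    then have "?p (Suc n) = 0" by force
    then show ?thesis by (intro exI[of _ n]) simp
  qed
  \<comment> \<open>This \<open>k\<close> is the number of rows longer than \<open>l\<close>;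
    minimality supplies the inner boundary condition.\<close>
  define k where "k = (LEAST n. ?p (Suc n) \<le> l)"
  have outer: "?p (Suc k) \<le> l" unfolding k_def using ex by (rule LeastI_ex)
  have inner: "k = 0 \<or> l \<le> ?p k"
  proof (cases k)
    case (Suc m)
    then have "\<not> ?p (Suc m) \<le> l" unfolding k_def by (metis lessI not_less_Least)
    then show ?thesis using Suc by simp
  qed simp
  obtain T where "T \<subseteq> points" "card T = (\<Sum>i=1..k. ?p i)" "colourable ne_comparable k T"
    using exists_ne_colouring by blast
  then have "(\<Sum>i=1..k. ?p i) + card S \<le> card (boxes ?p) + k * l"
    using weak_duality[of T S k l] assms by simp
  then show ?thesis
    using card_boxes_corner[OF is_partition_final finite_boxes inner outer] by simp
qed

end

section \<open>Chains of cells and colourings of units\<close>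

lemma exists_list_sorted_by_key:
  fixes key :: "'a \<Rightarrow> int"
  assumes "finite A" "inj_on key A"
  shows "\<exists>xs. set xs = A \<and> distinct xs \<and> sorted_wrt (\<lambda>a b. key a < key b) xs"
proof -
  obtain xs where xs: "set xs = A" "distinct xs" using finite_distinct_list[OF assms(1)] by blast
  have "sorted_wrt (<) (map key (sort_key key xs))"
    using xs assms(2) by (simp add: strict_sorted_iff distinct_map)
  then show ?thesis
    using xs by (intro exI[of _ "sort_key key xs"]) (simp add: sorted_wrt_map)
qed

lemma sorted_wrt_comparable:
  assumes "sorted_wrt Q xs" "a \<in> set xs" "b \<in> set xs" "a \<noteq> b"
  shows "Q a b \<or> Q b a"
  using assms by (induction xs) auto

lemma ne_chain_comparable:
  assumes "ne_chain f R C" "z \<in> set C" "w \<in> set C" "z \<noteq> w"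
  shows "ne_comparable z w"
proof -
  have "sorted_wrt (\<lambda>(j, i) (j', i'). j < j' \<and> i < i') C"
    using assms(1) unfolding ne_chain_def
    by (subst successively_conv_sorted_wrt[symmetric]) (auto intro!: transpI)
  from sorted_wrt_comparable[OF this assms(2-4)] show ?thesis
    by (auto simp: ne_comparable_def split: prod.splits)
qed

lemma ne_chain_distinct:
  assumes "ne_chain f R C"
  shows "distinct C"
proof -
  have "sorted_wrt (\<lambda>(j, i) (j', i'). j < j' \<and> i < i') C"
    using assms(1) unfolding ne_chain_def
    by (subst successively_conv_sorted_wrt[symmetric]) (auto intro!: transpI)
  then show ?thesis by (induction C) auto
qed

lemma SE_chain_incomparable:
  assumes "SE_chain f R C" "z \<in> set C" "w \<in> set C"
  shows "\<not> ne_comparable z w"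
proof (cases "z = w")
  case False
  have "sorted_wrt (\<lambda>(j, i) (j', i'). j \<le> j' \<and> i' \<le> i) C"
    using assms(1) unfolding SE_chain_def
    by (subst successively_conv_sorted_wrt[symmetric]) (auto intro!: transpI)
  from sorted_wrt_comparable[OF this assms(2,3) False] show ?thesis
    by (auto simp: ne_comparable_def split: prod.splits)
qed (simp add: ne_comparable_def)

lemma exists_ne_chain:
  assumes "finite A" "A \<subseteq> R" "\<And>z. z \<in> A \<Longrightarrow> f z \<noteq> 0"
    and "\<And>z w. z \<in> A \<Longrightarrow> w \<in> A \<Longrightarrow> z \<noteq> w \<Longrightarrow> ne_comparable z w"
  shows "\<exists>C. ne_chain f R C \<and> set C = A"
proof -
  have "inj_on (\<lambda>z. int (fst z)) A"
    using assms(4) by (force simp: inj_on_def ne_comparable_def)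
  from exists_list_sorted_by_key[OF assms(1) this] obtain C where
    C: "set C = A" "sorted_wrt (\<lambda>a b. int (fst a) < int (fst b)) C" by blast
  have "sorted_wrt (\<lambda>(j, i) (j', i'). j < j' \<and> i < i') C"
    by (rule sorted_wrt_mono_rel[OF _ C(2)]) (use assms(4) C(1) in \<open>fastforce simp: ne_comparable_def\<close>)
  then show ?thesis using C assms successively_if_sorted_wrt unfolding ne_chain_def by blast
qed

lemma exists_SE_chain:
  assumes "finite A" "A \<subseteq> R" "\<And>z. z \<in> A \<Longrightarrow> f z \<noteq> 0"
    and incomp: "\<And>z w. z \<in> A \<Longrightarrow> w \<in> A \<Longrightarrow> \<not> ne_comparable z w"
  shows "\<exists>C. SE_chain f R C \<and> set C = A"
proof -
  \<comment> \<open>Column minus row strictly grows along an SE-chain, even inside one column or one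
    row, and two distinct cells with equal key lie on a common diagonal and are
    ne-comparable.\<close>
  let ?key = "\<lambda>z. int (fst z) - int (snd z)"
  have "inj_on ?key A"
  proof (rule inj_onI)
    fix z w assume "z \<in> A" "w \<in> A" "?key z = ?key w"
    then show "z = w" using incomp[of z w] unfolding ne_comparable_def prod_eq_iff by linarith
  qed
  from exists_list_sorted_by_key[OF assms(1) this] obtain C where
    C: "set C = A" "distinct C" "sorted_wrt (\<lambda>a b. ?key a < ?key b) C" by blast
  have "sorted_wrt (\<lambda>(j, i) (j', i'). j \<le> j' \<and> i' \<le> i) C"
  proof (rule sorted_wrt_mono_rel[OF _ C(3)])
    fix z w assume "z \<in> set C" "w \<in> set C" "?key z < ?key w"
    then have "fst z \<le> fst w \<and> snd w \<le> snd z"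
      using incomp[of z w] C(1) unfolding ne_comparable_def by auto
    then show "(\<lambda>(j, i) (j', i'). j \<le> j' \<and> i' \<le> i) z w" by (simp add: case_prod_unfold)
  qed
  then show ?thesis using C assms successively_if_sorted_wrt unfolding SE_chain_def by blast
qed

lemma sum_list_conv_sum: "length xs = k \<Longrightarrow> (\<Sum>x\<leftarrow>xs. g x) = (\<Sum>n<k. g (xs ! n))"
  by (simp add: sum_list_sum_nth atLeast0LessThan)

lemma size_sum_list_mset: "size (\<Sum>C\<leftarrow>Cs. mset C) = (\<Sum>C\<leftarrow>Cs. length C)"
  by (induction Cs) auto

lemma colourable_Sigma:
  assumes "\<And>n u v. n < k \<Longrightarrow> u \<in> B n \<Longrightarrow> v \<in> B n \<Longrightarrow> u \<noteq> v \<Longrightarrow> Q u v"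
  shows "colourable (\<lambda>s t. Q (snd s) (snd t)) k (Sigma {..<k} B)"
  unfolding colourable_def using assms by (intro exI[of _ fst]) auto

lemma sum_over_colours:
  fixes c :: "'a \<Rightarrow> nat" and h :: "'a \<Rightarrow> nat"
  assumes "finite S" "\<And>u. u \<in> S \<Longrightarrow> c u < k"
  shows "(\<Sum>n<k. \<Sum>u | u \<in> S \<and> c u = n. h u) = sum h S"
  using assms by (intro sum.group) auto

definition units :: "(cell \<Rightarrow> nat) \<Rightarrow> cell set \<Rightarrow> (cell \<times> nat) set" where
  "units f R = Sigma R (\<lambda>z. {1..f z})"

text \<open>By the multiplicity condition each cell can hand out distinct units to the chains
  through it (\<open>e z\<close> is injective on \<open>N z\<close>). The chains become disjoint
  classes of units, and the multiset size becomes a cardinality.\<close>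

lemma ne_collection_imp_colouring:
  assumes coll: "ne_collection f R k Cs"
  shows "\<exists>S\<subseteq>units f R. card S = size (\<Sum>C\<leftarrow>Cs. mset C) \<and>
           colourable (\<lambda>u v. ne_comparable (fst u) (fst v)) k S"
proof -
  have len: "length Cs = k" and ch: "\<And>n. n < k \<Longrightarrow> ne_chain f R (Cs ! n)"
    and mult: "\<And>z. z \<in> R \<Longrightarrow> card {n. n < k \<and> z \<in> set (Cs ! n)} \<le> f z"
    using coll unfolding ne_collection_def by auto
  define N where "N z = {n. n < k \<and> z \<in> set (Cs ! n)}" for z
  have "\<forall>z\<in>R. \<exists>e. e ` N z \<subseteq> {1..f z} \<and> inj_on e (N z)"
  proof
    fix z assume "z \<in> R"
    then show "\<exists>e. e ` N z \<subseteq> {1..f z} \<and> inj_on e (N z)"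
      using mult by (intro card_le_inj) (simp_all add: N_def)
  qed
  from bchoice[OF this] obtain e where e: "\<And>z. z \<in> R \<Longrightarrow> e z ` N z \<subseteq> {1..f z}"
    "\<And>z. z \<in> R \<Longrightarrow> inj_on (e z) (N z)" by blast
  define T where "T = Sigma {..<k} (\<lambda>n. set (Cs ! n))"
  define g where "g s = (snd s, e (snd s) (fst s))" for s
  have "set (Cs ! n) \<subseteq> R" if "n < k" for n
    using ch[OF that] by (simp add: ne_chain_def)
  moreover have T: "fst s < k \<and> snd s \<in> set (Cs ! fst s)" if "s \<in> T" for s
    using that unfolding T_def by auto
  ultimately have R: "snd s \<in> R \<and> fst s \<in> N (snd s)" if "s \<in> T" for s
    using T[OF that] unfolding N_def by blast
  have inj: "inj_on g T"
  proof (rule inj_onI)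
    fix s t assume st: "s \<in> T" "t \<in> T" "g s = g t"
    then have eq: "snd s = snd t" "e (snd s) (fst s) = e (snd s) (fst t)" by (auto simp: g_def)
    then have "fst s = fst t" using inj_onD[OF e(2)[of "snd s"] eq(2)] R[OF st(1)] R[OF st(2)] by auto
    then show "s = t" using eq by (simp add: prod_eq_iff)
  qed
  have "card (set (Cs ! n)) = length (Cs ! n)" if "n < k" for n
    using distinct_card[OF ne_chain_distinct[OF ch[OF that]]] .
  then have "card T = (\<Sum>n<k. length (Cs ! n))"
    unfolding T_def by (subst card_SigmaI) (auto intro!: sum.cong)
  then have card: "card (g ` T) = size (\<Sum>C\<leftarrow>Cs. mset C)"
    using card_image[OF inj] sum_list_conv_sum[OF len, of length] by (simp add: size_sum_list_mset)
  have "colourable (\<lambda>s t. ne_comparable (snd s) (snd t)) k T"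
    unfolding T_def by (rule colourable_Sigma) (use ch ne_chain_comparable in blast)
  then have "colourable (\<lambda>u v. ne_comparable (fst u) (fst v)) k (g ` T)"
    by (rule colourable_image[OF _ inj]) (simp add: g_def)
  moreover have "g ` T \<subseteq> units f R"
    unfolding units_def g_def using R e(1) by fastforce
  ultimately show ?thesis using card by blast
qed

text \<open>Units of one cell are never comparable, hence lie in different classes. So projecting a
  class to its cells loses nothing, and at most \<open>f z\<close> classes meet
  \<open>z\<close>.\<close>

lemma ne_colouring_imp_collection:
  assumes fin: "finite R" and S: "S \<subseteq> units f R"
    and col: "colourable (\<lambda>u v. ne_comparable (fst u) (fst v)) k S"
  shows "\<exists>Cs. ne_collection f R k Cs \<and> size (\<Sum>C\<leftarrow>Cs. mset C) = card S"
proof -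
  obtain c where ck: "\<And>u. u \<in> S \<Longrightarrow> c u < k"
    and c: "\<And>u v. u \<in> S \<Longrightarrow> v \<in> S \<Longrightarrow> u \<noteq> v \<Longrightarrow> c u = c v \<Longrightarrow> ne_comparable (fst u) (fst v)"
    using col unfolding colourable_def by blast
  have finS: "finite S" using S fin finite_subset unfolding units_def by blast
  define A where "A n = fst ` {u \<in> S. c u = n}" for n
  have "\<exists>C. ne_chain f R C \<and> set C = A n" for n
  proof (rule exists_ne_chain)
    show "finite (A n)" unfolding A_def using finS by simp
    show "A n \<subseteq> R" unfolding A_def using S by (auto simp: units_def)
    show "f z \<noteq> 0" if "z \<in> A n" for z using that S unfolding A_def units_def by auto
    show "ne_comparable z w" if "z \<in> A n" "w \<in> A n" "z \<noteq> w" for z w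
      using that c unfolding A_def by force
  qed
  then obtain C where C: "\<And>n. ne_chain f R (C n)" "\<And>n. set (C n) = A n" by metis
  define Cs where "Cs = map C [0..<k]"
  have "card {n. n < k \<and> z \<in> set (Cs ! n)} \<le> f z" for z
  proof -
    have "{n. n < k \<and> z \<in> set (Cs ! n)} \<subseteq> (\<lambda>t. c (z, t)) ` {1..f z}"
      using S C(2) unfolding Cs_def A_def units_def by force
    then show ?thesis using surj_card_le[of "{1..f z}"] by simp
  qed
  then have "ne_collection f R k Cs"
    unfolding ne_collection_def using C(1) by (auto simp: Cs_def)
  moreover have "size (\<Sum>C\<leftarrow>Cs. mset C) = card S"
  proof -
    have "length (C n) = card {u \<in> S. c u = n}" for n
    proof -
      have "inj_on fst {u \<in> S. c u = n}"
        using c by (intro inj_onI) (force simp: ne_comparable_def)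
      then show ?thesis
        using distinct_card[OF ne_chain_distinct[OF C(1)[of n]]] C(2)[of n] by (simp add: A_def card_image)
    qed
    then have "size (\<Sum>C\<leftarrow>Cs. mset C) = (\<Sum>n<k. card {u \<in> S. c u = n})"
      using sum_list_conv_sum[of Cs k length] size_sum_list_mset[of Cs] by (simp add: Cs_def)
    also have "\<dots> = card S"
      using sum_over_colours[OF finS ck, where h = "\<lambda>_. 1"] by simp
    finally show ?thesis .
  qed
  ultimately show ?thesis by blast
qed

text \<open>Disjointness allows every cell of a chain to contribute all its units, which turns the
  sum of entries into a cardinality.\<close>

lemma SE_collection_imp_colouring:
  assumes coll: "SE_collection f R k Cs"
  shows "\<exists>S\<subseteq>units f R. card S = (\<Sum>C\<leftarrow>Cs. SE_length f C) \<and>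
           colourable (\<lambda>u v. \<not> ne_comparable (fst u) (fst v)) k S"
proof -
  have len: "length Cs = k" and ch: "\<And>n. n < k \<Longrightarrow> SE_chain f R (Cs ! n)"
    and disj: "\<And>n n'. n < k \<Longrightarrow> n' < k \<Longrightarrow> n \<noteq> n' \<Longrightarrow> set (Cs ! n) \<inter> set (Cs ! n') = {}"
    using coll unfolding SE_collection_def by auto
  define T where "T = Sigma {..<k} (\<lambda>n. units f (set (Cs ! n)))"
  have inj: "inj_on snd T"
    using disj unfolding T_def units_def inj_on_def by fastforce
  have "card (units f (set (Cs ! n))) = SE_length f (Cs ! n)" if "n < k" for n
  proof -
    have "distinct (Cs ! n)" using ch[OF that] by (simp add: SE_chain_def)
    then show ?thesis by (simp add: units_def SE_length_def sum_list_distinct_conv_sum_set)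
  qed
  then have "card T = (\<Sum>n<k. SE_length f (Cs ! n))"
    unfolding T_def by (subst card_SigmaI) (auto simp: units_def)
  then have card: "card (snd ` T) = (\<Sum>C\<leftarrow>Cs. SE_length f C)"
    using card_image[OF inj] sum_list_conv_sum[OF len, of "SE_length f"] by simp
  have "colourable (\<lambda>s t. (\<lambda>u v. \<not> ne_comparable (fst u) (fst v)) (snd s) (snd t)) k T"
    unfolding T_def
    by (rule colourable_Sigma) (use ch SE_chain_incomparable in \<open>force simp: units_def\<close>)
  then have "colourable (\<lambda>u v. \<not> ne_comparable (fst u) (fst v)) k (snd ` T)"
    by (rule colourable_image[OF _ inj]) simp
  moreover have "snd ` T \<subseteq> units f R"
    using ch unfolding T_def units_def SE_chain_def by fastforce
  ultimately show ?thesis using card by blast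
qed

text \<open>Units of one cell are pairwise incomparable, so a cell may be coloured by the colour of any
  of its units, and all its other units may be added to the same class.\<close>

lemma SE_colouring_imp_collection:
  assumes fin: "finite R" and S: "S \<subseteq> units f R"
    and col: "colourable (\<lambda>u v. \<not> ne_comparable (fst u) (fst v)) k S"
  shows "\<exists>Cs. SE_collection f R k Cs \<and> card S \<le> (\<Sum>C\<leftarrow>Cs. SE_length f C)"
proof -
  obtain c where ck: "\<And>u. u \<in> S \<Longrightarrow> c u < k"
    and c: "\<And>u v. u \<in> S \<Longrightarrow> v \<in> S \<Longrightarrow> u \<noteq> v \<Longrightarrow> c u = c v \<Longrightarrow> \<not> ne_comparable (fst u) (fst v)"
    using col unfolding colourable_def by blast
  have finS: "finite S" using S fin finite_subset unfolding units_def by blast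
  define Z where "Z = fst ` S"
  have finZ: "finite Z" using finS unfolding Z_def by simp
  define t where "t z = (SOME t. (z, t) \<in> S)" for z
  have t: "(z, t z) \<in> S" if "z \<in> Z" for z
    unfolding t_def by (rule someI_ex) (use that in \<open>force simp: Z_def\<close>)
  define A where "A n = {z \<in> Z. c (z, t z) = n}" for n
  have "\<exists>C. SE_chain f R C \<and> set C = A n" for n
  proof (rule exists_SE_chain)
    show "finite (A n)" unfolding A_def using finZ by simp
    show "A n \<subseteq> R" unfolding A_def Z_def using S by (auto simp: units_def)
    show "f z \<noteq> 0" if "z \<in> A n" for z using that S unfolding A_def Z_def units_def by auto
    show "\<not> ne_comparable z w" if "z \<in> A n" "w \<in> A n" for z w
    proof (cases "z = w")
      case False
      then show ?thesis using that c[of "(z, t z)" "(w, t w)"] t unfolding A_def by simp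
    qed (simp add: ne_comparable_def)
  qed
  then obtain C where C: "\<And>n. SE_chain f R (C n)" "\<And>n. set (C n) = A n" by metis
  define Cs where "Cs = map C [0..<k]"
  have "SE_collection f R k Cs"
    unfolding SE_collection_def using C by (auto simp: Cs_def A_def)
  moreover have "card S \<le> (\<Sum>C\<leftarrow>Cs. SE_length f C)"
  proof -
    have "S \<subseteq> units f Z" using S unfolding Z_def units_def by force
    then have "card S \<le> card (units f Z)" using finZ by (intro card_mono) (auto simp: units_def)
    also have "\<dots> = sum f Z" using finZ by (simp add: units_def)
    also have "\<dots> = (\<Sum>n<k. sum f (A n))"
      using sum_over_colours[OF finZ, of "\<lambda>z. c (z, t z)" k f] ck t unfolding A_def by simp
    also have "\<dots> = (\<Sum>n<k. SE_length f (C n))"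
    proof (rule sum.cong)
      fix n
      have "distinct (C n)" using C(1)[of n] by (simp add: SE_chain_def)
      then show "sum f (A n) = SE_length f (C n)"
        using C(2)[of n] by (simp add: SE_length_def sum_list_distinct_conv_sum_set)
    qed simp
    also have "\<dots> = (\<Sum>C\<leftarrow>Cs. SE_length f C)"
      using sum_list_conv_sum[of Cs k "SE_length f"] by (simp add: Cs_def)
    finally show ?thesis .
  qed
  ultimately show ?thesis by blast
qed

section \<open>The blown-up filling\<close>

lemma ferrers_shape_facts:
  assumes "ferrers_shape F"
  shows "finite F" and "\<And>j i. (j, i) \<in> F \<Longrightarrow> 1 \<le> j \<and> 1 \<le> i"
    and "\<And>j i j' i'. (j, i) \<in> F \<Longrightarrow> 1 \<le> j' \<Longrightarrow> j' \<le> j \<Longrightarrow> 1 \<le> i' \<Longrightarrow> i' \<le> i \<Longrightarrow> (j', i') \<in> F"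
proof -
  obtain m h where h: "\<And>j j'. 1 \<le> j \<Longrightarrow> j \<le> j' \<Longrightarrow> j' \<le> m \<Longrightarrow> h j' \<le> h j"
    and F: "F = {(j, i). 1 \<le> j \<and> j \<le> m \<and> 1 \<le> i \<and> i \<le> h j}"
    using assms unfolding ferrers_shape_def by blast
  have "F = Sigma {1..m} (\<lambda>j. {1..h j})" unfolding F by auto
  then show "finite F" by simp
  show "1 \<le> j \<and> 1 \<le> i" if "(j, i) \<in> F" for j i using that unfolding F by simp
  show "(j', i') \<in> F" if "(j, i) \<in> F" "1 \<le> j'" "j' \<le> j" "1 \<le> i'" "i' \<le> i" for j i j' i'
    using that h[of j' j] unfolding F by simp
qed

lemma rectangle_below_corner:
  assumes "ferrers_shape F" "(x, y) \<in> corners F" "1 \<le> j" "j \<le> x" "1 \<le> i" "i \<le> y"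
  shows "(j, i) \<in> F"
proof -
  obtain j0 i0 where "(j0, i0) \<in> F" "x \<le> j0" "y \<le> i0"
    using assms(2) unfolding corners_def cell_corners_def by auto
  then show ?thesis using ferrers_shape_facts(3)[OF assms(1), of j0 i0 j i] assms by auto
qed

lemma exists_block:
  fixes E :: "nat \<Rightarrow> nat"
  assumes "E 0 = 0" "1 \<le> c" "c \<le> E x"
  shows "\<exists>j. 1 \<le> j \<and> j \<le> x \<and> E (j - 1) < c \<and> c \<le> E j"
  using assms(3)
proof (induction x)
  case 0 then show ?case using assms by simp
next
  case (Suc x)
  show ?case
  proof (cases "c \<le> E x")
    case True then show ?thesis using Suc.IH by (meson le_Suc_eq)
  next
    case False then show ?thesis using Suc.prems by (intro exI[of _ "Suc x"]) auto
  qed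
qed

locale ferrers_filling =
  fixes F :: "cell set" and f :: "cell \<Rightarrow> nat"
  assumes ferrers: "ferrers_shape F"
begin

lemmas finite_F = ferrers_shape_facts(1)[OF ferrers]
lemmas F_ge_1 = ferrers_shape_facts(2)[OF ferrers]

lemma finite_column: "finite {i. (j, i) \<in> F \<and> Q i}"
  by (rule finite_subset[of _ "snd ` F"]) (use finite_F in force)+

lemma finite_row: "finite {j. (j, i) \<in> F \<and> Q j}"
  by (rule finite_subset[of _ "fst ` F"]) (use finite_F in force)+

lemma col_end_mono: "j \<le> j' \<Longrightarrow> col_end F f j \<le> col_end F f j'"
  unfolding col_end_def by (rule sum_mono2) auto

lemma row_end_mono: "i \<le> i' \<Longrightarrow> row_end F f i \<le> row_end F f i'"
  unfolding row_end_def by (rule sum_mono2) auto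

lemma col_end_step: "1 \<le> j \<Longrightarrow> col_end F f (j - 1) + col_sum F f j \<le> col_end F f j"
  unfolding col_end_def by (cases j) auto

lemma row_end_step: "1 \<le> i \<Longrightarrow> row_end F f (i - 1) + row_sum F f i \<le> row_end F f i"
  unfolding row_end_def by (cases i) auto

lemma column_offset:
  assumes "(j, i) \<in> F"
  shows "(\<Sum>i' | (j, i') \<in> F \<and> i < i'. f (j, i')) + f (j, i) \<le> col_sum F f j"
    and "i' < i \<Longrightarrow> (\<Sum>e | (j, e) \<in> F \<and> i < e. f (j, e)) + f (j, i) \<le> (\<Sum>e | (j, e) \<in> F \<and> i' < e. f (j, e))"
proof -
  have ins: "(\<Sum>e | (j, e) \<in> F \<and> i < e. f (j, e)) + f (j, i)
      = (\<Sum>e\<in>insert i {e. (j, e) \<in> F \<and> i < e}. f (j, e))"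
    using finite_column by simp
  show "(\<Sum>i' | (j, i') \<in> F \<and> i < i'. f (j, i')) + f (j, i) \<le> col_sum F f j"
    unfolding ins col_sum_def using assms finite_column[of j "\<lambda>_. True"] by (intro sum_mono2) auto
  show "(\<Sum>e | (j, e) \<in> F \<and> i < e. f (j, e)) + f (j, i) \<le> (\<Sum>e | (j, e) \<in> F \<and> i' < e. f (j, e))" if "i' < i"
    unfolding ins using assms that finite_column by (intro sum_mono2) auto
qed

lemma row_offset:
  assumes "(j, i) \<in> F"
  shows "(\<Sum>j' | (j', i) \<in> F \<and> j' < j. f (j', i)) + f (j, i) \<le> row_sum F f i"
    and "j < j' \<Longrightarrow> (\<Sum>e | (e, i) \<in> F \<and> e < j. f (e, i)) + f (j, i) \<le> (\<Sum>e | (e, i) \<in> F \<and> e < j'. f (e, i))"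
proof -
  have ins: "(\<Sum>e | (e, i) \<in> F \<and> e < j. f (e, i)) + f (j, i)
      = (\<Sum>e\<in>insert j {e. (e, i) \<in> F \<and> e < j}. f (e, i))"
    using finite_row by simp
  show "(\<Sum>j' | (j', i) \<in> F \<and> j' < j. f (j', i)) + f (j, i) \<le> row_sum F f i"
    unfolding ins row_sum_def using assms finite_row[of i "\<lambda>_. True"] by (intro sum_mono2) auto
  show "(\<Sum>e | (e, i) \<in> F \<and> e < j. f (e, i)) + f (j, i) \<le> (\<Sum>e | (e, i) \<in> F \<and> e < j'. f (e, i))" if "j < j'"
    unfolding ins using assms that finite_row by (intro sum_mono2) auto
qed

section \<open>Order of the units in the blown-up shape\<close>

definition ucol :: "cell \<times> nat \<Rightarrow> nat" where
  "ucol u = unit_col F f (fst (fst u)) (snd (fst u)) (snd u)"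

definition urow :: "cell \<times> nat \<Rightarrow> nat" where
  "urow u = unit_row F f (fst (fst u)) (snd (fst u)) (snd u)"

lemma ucol_bounds:
  assumes "((j, i), t) \<in> units f F"
  shows "col_end F f (j - 1) < ucol ((j, i), t)" "ucol ((j, i), t) \<le> col_end F f j"
  using assms column_offset(1)[of j i] col_end_step[of j] F_ge_1[of j i]
  by (auto simp: units_def ucol_def unit_col_def)

text \<open>The additive form records that the truncated subtraction in \<open>unit_row\<close>
  loses nothing: the offset and \<open>t\<close> together do not exceed the row sum.\<close>

lemma urow_eq:
  assumes "((j, i), t) \<in> units f F"
  shows "urow ((j, i), t) + (\<Sum>j' | (j', i) \<in> F \<and> j' < j. f (j', i)) + t = row_end F f i + 1"
  using assms row_offset(1)[of j i] row_end_step[of i] F_ge_1[of j i]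
  by (auto simp: units_def urow_def unit_row_def)

lemma urow_bounds:
  assumes "((j, i), t) \<in> units f F"
  shows "row_end F f (i - 1) < urow ((j, i), t)" "urow ((j, i), t) \<le> row_end F f i"
  using assms urow_eq[OF assms] row_offset(1)[of j i] row_end_step[of i] F_ge_1[of j i]
  by (auto simp: units_def)

text \<open>Units are ordered lexicographically: by column from left to right, then by row
  downwards, then by index. For \<open>urow_less\<close> the order is by row upwards, then by column
  leftwards, then by decreasing index.\<close>

lemma ucol_less:
  assumes u: "((j, i), t) \<in> units f F" and v: "((j', i'), t') \<in> units f F"
    and "j < j' \<or> j = j' \<and> i' < i \<or> j = j' \<and> i = i' \<and> t < t'"
  shows "ucol ((j, i), t) < ucol ((j', i'), t')"
  using assms(3)
proof (elim disjE conjE)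
  assume "j < j'"
  then have "col_end F f j \<le> col_end F f (j' - 1)" by (intro col_end_mono) simp
  then show ?thesis using ucol_bounds(2)[OF u] ucol_bounds(1)[OF v] by simp
next
  assume "j = j'" "i' < i"
  then show ?thesis using column_offset(2)[of j i i'] u v by (auto simp: ucol_def unit_col_def units_def)
qed (auto simp: ucol_def unit_col_def)

lemma urow_less:
  assumes u: "((j, i), t) \<in> units f F" and v: "((j', i'), t') \<in> units f F"
    and "i < i' \<or> i = i' \<and> j' < j \<or> i = i' \<and> j = j' \<and> t' < t"
  shows "urow ((j, i), t) < urow ((j', i'), t')"
  using assms(3)
proof (elim disjE conjE)
  assume "i < i'"
  then have "row_end F f i \<le> row_end F f (i' - 1)" by (intro row_end_mono) simp
  then show ?thesis using urow_bounds(2)[OF u] urow_bounds(1)[OF v] by simp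
next
  assume *: "i = i'" "j' < j"
  then have "(\<Sum>e | (e, i) \<in> F \<and> e < j'. f (e, i)) + t' \<le> (\<Sum>e | (e, i) \<in> F \<and> e < j. f (e, i))"
    using row_offset(2)[of j' i j] v by (auto simp: units_def)
  moreover have "1 \<le> t" using u by (simp add: units_def)
  ultimately show ?thesis using * urow_eq[OF u] urow_eq[OF v] by simp
next
  assume "i = i'" "j = j'" "t' < t"
  then show ?thesis using urow_eq[OF u] urow_eq[OF v] by simp
qed

text \<open>A strict difference of cell coordinates keeps its sign, and every tie is broken from
  top-left to bottom-right. Thus a tie never creates a north-east pair.\<close>

lemma unit_positions:
  assumes u: "u \<in> units f F" and v: "v \<in> units f F" and "u \<noteq> v"
  shows "ucol u \<noteq> ucol v" "urow u \<noteq> urow v"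
    and "ne_comparable (ucol u, urow u) (ucol v, urow v) \<longleftrightarrow> ne_comparable (fst u) (fst v)"
proof -
  obtain j i t j' i' t' where e: "u = ((j, i), t)" "v = ((j', i'), t')" by (metis prod.collapse)
  note U = u[unfolded e] and V = v[unfolded e]
  note l = ucol_less[OF U V] ucol_less[OF V U] urow_less[OF U V] urow_less[OF V U]
  have ne: "j < j' \<or> j' < j \<or> i < i' \<or> i' < i \<or> t < t' \<or> t' < t"
    using assms(3) unfolding e by auto
  show "ucol u \<noteq> ucol v" "urow u \<noteq> urow v"
    unfolding e using l ne
    by (cases j j' rule: linorder_cases; cases i i' rule: linorder_cases;
        cases t t' rule: linorder_cases; simp)+
  show "ne_comparable (ucol u, urow u) (ucol v, urow v) \<longleftrightarrow> ne_comparable (fst u) (fst v)"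
    unfolding e ne_comparable_def fst_conv snd_conv using l ne
    by (cases j j' rule: linorder_cases; cases i i' rule: linorder_cases;
        cases t t' rule: linorder_cases; simp)
qed

lemma blowup_ones_eq: "blowup_ones F f = (\<lambda>u. (ucol u, urow u)) ` units f F"
proof
  show "blowup_ones F f \<subseteq> (\<lambda>u. (ucol u, urow u)) ` units f F"
  proof
    fix z assume "z \<in> blowup_ones F f"
    then obtain j i t where "z = (unit_col F f j i t, unit_row F f j i t)" "(j, i) \<in> F" "1 \<le> t" "t \<le> f (j, i)"
      unfolding blowup_ones_def by blast
    then show "z \<in> (\<lambda>u. (ucol u, urow u)) ` units f F"
      by (intro image_eqI[of _ _ "((j, i), t)"]) (simp_all add: units_def ucol_def urow_def)
  qed
  show "(\<lambda>u. (ucol u, urow u)) ` units f F \<subseteq> blowup_ones F f"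
    unfolding blowup_ones_def units_def ucol_def urow_def by clarsimp blast
qed

end

locale ferrers_corner = ferrers_filling +
  fixes x y :: nat
  assumes corner: "(x, y) \<in> corners F"
begin

lemma rook_growth:
  "rook_growth (blowup_shape F f) (blowup_ones F f) (col_end F f x) (row_end F f y)"
proof
  fix c a assume ca: "1 \<le> c" "c \<le> col_end F f x" "1 \<le> a" "a \<le> row_end F f y"
  obtain j where j: "1 \<le> j" "j \<le> x" "col_end F f (j - 1) < c" "c \<le> col_end F f j"
    using exists_block[of "col_end F f" c x] ca by (auto simp: col_end_def)
  obtain i where i: "1 \<le> i" "i \<le> y" "row_end F f (i - 1) < a" "a \<le> row_end F f i"
    using exists_block[of "row_end F f" a y] ca by (auto simp: row_end_def)
  show "(c, a) \<in> blowup_shape F f"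
    using rectangle_below_corner[OF ferrers corner j(1,2) i(1,2)] j i
    unfolding blowup_shape_def by blast
next
  fix c c' a assume "(c, a) \<in> blowup_ones F f" "(c', a) \<in> blowup_ones F f"
  then show "c = c'" unfolding blowup_ones_eq using unit_positions(2) by fastforce
next
  fix c a a' assume "(c, a) \<in> blowup_ones F f" "(c, a') \<in> blowup_ones F f"
  then show "a = a'" unfolding blowup_ones_eq using unit_positions(1) by fastforce
qed

sublocale G: rook_growth "blowup_shape F f" "blowup_ones F f" "col_end F f x" "row_end F f y"
  by (rule rook_growth)

abbreviation "U \<equiv> units f (region F x y)"

lemma U_subset: "U \<subseteq> units f F"
  unfolding units_def region_def by auto

lemma finite_region: "finite (region F x y)"
  by (rule finite_subset[OF _ finite_F]) (auto simp: region_def)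

lemma inj_on_U: "inj_on (\<lambda>u. (ucol u, urow u)) U"
proof (rule inj_onI, rule ccontr)
  fix u v assume "u \<in> U" "v \<in> U" "(ucol u, urow u) = (ucol v, urow v)" "u \<noteq> v"
  then show False using unit_positions(1)[of u v] U_subset by auto
qed

text \<open>The lines through the corner run along block ends and cut no block, so a unit lies in
  the rectangle exactly when its cell lies in the region.\<close>

lemma points_eq_U: "G.points = (\<lambda>u. (ucol u, urow u)) ` U"
proof
  show "G.points \<subseteq> (\<lambda>u. (ucol u, urow u)) ` U"
  proof
    fix z assume "z \<in> G.points"
    then obtain u where u: "u \<in> units f F" "z = (ucol u, urow u)"
      "ucol u \<le> col_end F f x" "urow u \<le> row_end F f y"
      unfolding G.points_def unfolding blowup_ones_eq by auto
    obtain j i t where e: "u = ((j, i), t)" by (metis prod.collapse)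
    have "\<not> x < j"
      using col_end_mono[of x "j - 1"] ucol_bounds(1)[of j i t] u e by fastforce
    moreover have "\<not> y < i"
      using row_end_mono[of y "i - 1"] urow_bounds(1)[of j i t] u e by fastforce
    ultimately have "u \<in> U" using u(1) unfolding e units_def region_def by auto
    then show "z \<in> (\<lambda>u. (ucol u, urow u)) ` U" using u by blast
  qed
  show "(\<lambda>u. (ucol u, urow u)) ` U \<subseteq> G.points"
  proof
    fix z assume "z \<in> (\<lambda>u. (ucol u, urow u)) ` U"
    then obtain u where u: "u \<in> U" "z = (ucol u, urow u)" by blast
    obtain j i t where e: "u = ((j, i), t)" by (metis prod.collapse)
    have uF: "((j, i), t) \<in> units f F" and ji: "j \<le> x" "i \<le> y"
      using u U_subset e unfolding units_def region_def by auto
    show "z \<in> G.points"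
      using ucol_bounds[OF uF] urow_bounds[OF uF] col_end_mono[OF ji(1)] row_end_mono[OF ji(2)] uF u(2)
      unfolding G.points_def unfolding blowup_ones_eq e by auto
  qed
qed

section \<open>Maxima over collections of chains\<close>

abbreviation "lam \<equiv> dual_rsk'_label F f x y"

lemma exists_unit_colouring:
  assumes "\<exists>S\<subseteq>G.points. card S = N \<and> colourable Q k S"
    and "\<And>u v. u \<in> U \<Longrightarrow> v \<in> U \<Longrightarrow> u \<noteq> v \<Longrightarrow> Q (ucol u, urow u) (ucol v, urow v) \<Longrightarrow> Q' u v"
  shows "\<exists>S\<subseteq>U. card S = N \<and> colourable Q' k S"
proof -
  obtain S0 where S0: "S0 \<subseteq> G.points" "card S0 = N" "colourable Q k S0" using assms(1) by blast
  obtain S where S: "S \<subseteq> U" "S0 = (\<lambda>u. (ucol u, urow u)) ` S"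
    by (rule subset_imageE[OF S0(1)[unfolded points_eq_U]])
  have inj: "inj_on (\<lambda>u. (ucol u, urow u)) S" using inj_on_U S(1) inj_on_subset by blast
  have "colourable Q' k S"
    by (rule colourable_inverse_image[OF S0(3)[unfolded S(2)] inj]) (use S(1) assms(2) in blast)
  moreover have "card S = N" using card_image[OF inj] S0 S by simp
  ultimately show ?thesis using S(1) by blast
qed

lemma unit_colouring_image:
  assumes "S \<subseteq> U" "colourable Q' k S"
    and "\<And>u v. u \<in> U \<Longrightarrow> v \<in> U \<Longrightarrow> u \<noteq> v \<Longrightarrow> Q' u v \<Longrightarrow> Q (ucol u, urow u) (ucol v, urow v)"
  shows "\<exists>S0\<subseteq>G.points. card S0 = card S \<and> colourable Q k S0"
proof -
  have inj: "inj_on (\<lambda>u. (ucol u, urow u)) S" using inj_on_U assms(1) inj_on_subset by blast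
  have "colourable Q k ((\<lambda>u. (ucol u, urow u)) ` S)"
    by (rule colourable_image[OF assms(2) inj]) (use assms in blast)
  then show ?thesis
    using card_image[OF inj] assms(1) points_eq_U
    by (intro exI[of _ "(\<lambda>u. (ucol u, urow u)) ` S"]) auto
qed

lemma ne_comparable_units:
  assumes "u \<in> U" "v \<in> U" "u \<noteq> v"
  shows "ne_comparable (ucol u, urow u) (ucol v, urow v) \<longleftrightarrow> ne_comparable (fst u) (fst v)"
  using unit_positions(3)[OF subsetD[OF U_subset] subsetD[OF U_subset]] assms by simp

lemma ne_maximum:
  "is_maximum {size (\<Sum>C\<leftarrow>Cs. mset C) | Cs. ne_collection f (region F x y) k Cs} (\<Sum>i=1..k. lam i)"
  unfolding is_maximum_def
proof
  have "\<exists>S\<subseteq>U. card S = (\<Sum>i=1..k. lam i) \<and> colourable (\<lambda>u v. ne_comparable (fst u) (fst v)) k S"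
    unfolding dual_rsk'_label_def
    by (rule exists_unit_colouring[OF G.exists_ne_colouring]) (simp add: ne_comparable_units)
  then obtain S where S: "S \<subseteq> U" "card S = (\<Sum>i=1..k. lam i)"
    "colourable (\<lambda>u v. ne_comparable (fst u) (fst v)) k S" by blast
  obtain Cs where "ne_collection f (region F x y) k Cs" "size (\<Sum>C\<leftarrow>Cs. mset C) = card S"
    using ne_colouring_imp_collection[OF finite_region S(1,3)] by blast
  then show "(\<Sum>i=1..k. lam i) \<in> {size (\<Sum>C\<leftarrow>Cs. mset C) | Cs. ne_collection f (region F x y) k Cs}"
    using S(2) by (intro CollectI exI[of _ Cs]) simp
  show "\<forall>s\<in>{size (\<Sum>C\<leftarrow>Cs. mset C) | Cs. ne_collection f (region F x y) k Cs}. s \<le> (\<Sum>i=1..k. lam i)"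
  proof clarify
    fix Cs assume coll: "ne_collection f (region F x y) k Cs"
    obtain S where S: "S \<subseteq> U" "card S = size (\<Sum>C\<leftarrow>Cs. mset C)"
      "colourable (\<lambda>u v. ne_comparable (fst u) (fst v)) k S"
      using ne_collection_imp_colouring[OF coll] by blast
    have "\<exists>S0\<subseteq>G.points. card S0 = card S \<and> colourable ne_comparable k S0"
      by (rule unit_colouring_image[OF S(1,3)]) (simp add: ne_comparable_units)
    then obtain S0 where S0: "S0 \<subseteq> G.points" "card S0 = card S" "colourable ne_comparable k S0" by blast
    then show "size (\<Sum>C\<leftarrow>Cs. mset C) \<le> (\<Sum>i=1..k. lam i)"
      using G.ne_colouring_bound[OF S0(1,3)] S0(2) S(2) unfolding dual_rsk'_label_def by simp
  qed
qed

text \<open>Filling up cells may enlarge a coloured set, so a collection obtained from a colouring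
  is only known to have at least the wanted sum; the upper bound, shown beforehand, forces
  equality.\<close>

lemma SE_maximum:
  "is_maximum {(\<Sum>C\<leftarrow>Cs. SE_length f C) | Cs. SE_collection f (region F x y) k Cs}
     (\<Sum>i=1..k. conjugate lam i)"
  unfolding is_maximum_def
proof
  show upper: "\<forall>s\<in>{(\<Sum>C\<leftarrow>Cs. SE_length f C) | Cs. SE_collection f (region F x y) k Cs}.
      s \<le> (\<Sum>i=1..k. conjugate lam i)"
  proof clarify
    fix Cs assume coll: "SE_collection f (region F x y) k Cs"
    obtain S where S: "S \<subseteq> U" "card S = (\<Sum>C\<leftarrow>Cs. SE_length f C)"
      "colourable (\<lambda>u v. \<not> ne_comparable (fst u) (fst v)) k S"
      using SE_collection_imp_colouring[OF coll] by blast
    have "\<exists>S0\<subseteq>G.points. card S0 = card S \<and> colourable (\<lambda>u v. \<not> ne_comparable u v) k S0"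
      by (rule unit_colouring_image[OF S(1,3)]) (simp add: ne_comparable_units)
    then obtain S0 where S0: "S0 \<subseteq> G.points" "card S0 = card S" "colourable (\<lambda>u v. \<not> ne_comparable u v) k S0" by blast
    then show "(\<Sum>C\<leftarrow>Cs. SE_length f C) \<le> (\<Sum>i=1..k. conjugate lam i)"
      using G.SE_colouring_bound[OF S0(1,3)] S0(2) S(2) unfolding dual_rsk'_label_def by simp
  qed
  have "\<exists>S\<subseteq>U. card S = (\<Sum>i=1..k. conjugate lam i) \<and> colourable (\<lambda>u v. \<not> ne_comparable (fst u) (fst v)) k S"
    unfolding dual_rsk'_label_def
    by (rule exists_unit_colouring[OF G.exists_SE_colouring]) (simp add: ne_comparable_units)
  then obtain S where S: "S \<subseteq> U" "card S = (\<Sum>i=1..k. conjugate lam i)"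
    "colourable (\<lambda>u v. \<not> ne_comparable (fst u) (fst v)) k S" by blast
  obtain Cs where "SE_collection f (region F x y) k Cs" "card S \<le> (\<Sum>C\<leftarrow>Cs. SE_length f C)"
    using SE_colouring_imp_collection[OF finite_region S(1,3)] by blast
  moreover from this have "(\<Sum>C\<leftarrow>Cs. SE_length f C) \<le> (\<Sum>i=1..k. conjugate lam i)"
    using upper by blast
  ultimately show "(\<Sum>i=1..k. conjugate lam i)
      \<in> {(\<Sum>C\<leftarrow>Cs. SE_length f C) | Cs. SE_collection f (region F x y) k Cs}"
    using S(2) by (intro CollectI exI[of _ Cs]) simp
qed

lemma single_ne_chain:
  "{size (\<Sum>C\<leftarrow>Cs. mset C) | Cs. ne_collection f (region F x y) 1 Cs}
     = {ne_length C | C. ne_chain f (region F x y) C}"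
proof -
  have single: "ne_collection f (region F x y) 1 Cs \<longleftrightarrow> (\<exists>C. Cs = [C] \<and> ne_chain f (region F x y) C)" for Cs
  proof
    assume "\<exists>C. Cs = [C] \<and> ne_chain f (region F x y) C"
    then obtain C where C: "Cs = [C]" "ne_chain f (region F x y) C" by blast
    \<comment> \<open>A single chain contributes at most one to each cell, and its cells carry
      nonzero entries, so the multiplicity condition is automatic.\<close>
    have "card {n. n < 1 \<and> z \<in> set (Cs ! n)} \<le> f z" for z
    proof (cases "z \<in> set C")
      case True
      then have e: "{n. n < 1 \<and> z \<in> set (Cs ! n)} = {0}" and "f z \<noteq> 0"
        using C by (auto simp: ne_chain_def)
      then show ?thesis unfolding e by simp
    next
      case False
      then have e: "{n. n < 1 \<and> z \<in> set (Cs ! n)} = {}" using C by (auto simp: less_Suc_eq)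
      show ?thesis unfolding e by simp
    qed
    then show "ne_collection f (region F x y) 1 Cs" using C by (simp add: ne_collection_def)
  qed (auto simp: ne_collection_def length_Suc_conv)
  have "{size (\<Sum>C\<leftarrow>Cs. mset C) | Cs. ne_collection f (region F x y) 1 Cs}
      = {size (\<Sum>C\<leftarrow>[C]. mset C) | C. ne_chain f (region F x y) C}"
    unfolding single by blast
  then show ?thesis by (simp add: ne_length_def)
qed

lemma single_SE_chain:
  "{(\<Sum>C\<leftarrow>Cs. SE_length f C) | Cs. SE_collection f (region F x y) 1 Cs}
     = {SE_length f C | C. SE_chain f (region F x y) C}"
proof -
  have single: "SE_collection f (region F x y) 1 Cs \<longleftrightarrow> (\<exists>C. Cs = [C] \<and> SE_chain f (region F x y) C)" for Cs
    by (auto simp: SE_collection_def length_Suc_conv)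
  have "{(\<Sum>C\<leftarrow>Cs. SE_length f C) | Cs. SE_collection f (region F x y) 1 Cs}
      = {(\<Sum>C\<leftarrow>[C]. SE_length f C) | C. SE_chain f (region F x y) C}"
    unfolding single by blast
  then show ?thesis by simp
qed

end

theorem theorem12:
  fixes F :: "(nat \<times> nat) set" and f :: "nat \<times> nat \<Rightarrow> nat" and x y :: nat and lam :: "nat \<Rightarrow> nat"
  assumes "ferrers_shape F"
    and "(x, y) \<in> corners F"
    and "lam = dual_rsk'_label F f x y"
  shows "is_partition lam
    \<and> (\<forall>k\<ge>1. is_maximum
          {size (\<Sum>C\<leftarrow>Cs. mset C) | Cs. ne_collection f (region F x y) k Cs}
          (\<Sum>i=1..k. lam i))
    \<and> (\<forall>k\<ge>1. is_maximum
          {(\<Sum>C\<leftarrow>Cs. SE_length f C) | Cs. SE_collection f (region F x y) k Cs}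
          (\<Sum>i=1..k. conjugate lam i))
    \<and> is_maximum {ne_length C | C. ne_chain f (region F x y) C} (lam 1)
    \<and> is_maximum {SE_length f C | C. SE_chain f (region F x y) C} (conjugate lam 1)"
proof -
  interpret ferrers_corner F f x y by unfold_locales (use assms in auto)
  have "is_partition lam"
    unfolding assms(3) dual_rsk'_label_def by (rule G.is_partition_final)
  moreover have "is_maximum {ne_length C | C. ne_chain f (region F x y) C} (lam 1)"
    using ne_maximum[of 1] unfolding single_ne_chain assms(3) by simp
  moreover have "is_maximum {SE_length f C | C. SE_chain f (region F x y) C} (conjugate lam 1)"
    using SE_maximum[of 1] unfolding single_SE_chain assms(3) by simp
  ultimately show ?thesis using ne_maximum SE_maximum unfolding assms(3) by blast
qed

end
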